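(* Let $K$ and $L$ be finite simplicial complexes and let $f\colon K\to L$ be a non-degenerate simplicial map. Then the corresponding piecewise linear map $|f|\colon|K|\to|L|$ lifts to an embedding if and only if the following conditions hold: (1) the covering map $p_2\colon|K^{(2)}_f|\to|\widetilde{K}^{(2)}_f|$ is trivial; (2) the formula $\Gamma_f$ (which is defined whenever (1) holds) is satisfiable. Furthermore, when (1) holds, there exists a bijection between the assignments of the variables $x_1,\dots,x_n$ that satisfy $\Gamma_f$ and the isotopy classes of liftings of $|f|$.
   Context: $|K|$ denotes the geometric realisation of $K$, $V(K)$ its vertex set, and $|f|$ the piecewise linear map induced by a simplicial map $f$. A simplicial map $f$ between finite complexes is non-degenerate if it is injective on each simplex (equivalently, $|f|$ has finite point preimages). A piecewise linear map $\varphi\colon P\to Q$ of polyhedra lifts to an embedding if there is a piecewise linear embedding $\widetilde{\varphi}\colon P\to Q\times\mathbb{R}$ with $\varphi=\mathrm{pr}_Q\circ\widetilde{\varphi}$; such $\widetilde\varphi$ is called a lifting of $\varphi$. Two liftings are isotopic if they are connected by an isotopy through liftings, i.e. a continuous map $F\colon P\times[0,1]\to Q\times\mathbb{R}$ such that each $F(\cdot,t)$ is a lifting of $\varphi$ and $F(\cdot,0)$, $F(\cdot,1)$ are the given liftings. $K^{(2)}_f$ is the simplicial complex whose vertices are ordered pairs of distinct vertices of $K$ with the same image under $f$; a set $\{(v_1^1,v_2^1),\dots,(v_1^{k+1},v_2^{k+1})\}$ of $k+1$ vertices forms a $k$-simplex if for $j=1,2$ the set $\{v_j^1,\dots,v_j^{k+1}\}$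 forms a $k$-simplex of $K$. Let $\tau$ be the involution of $K^{(2)}_f$ (and of $|K^{(2)}_f|$) swapping the entries of pairs, $\widetilde{K}^{(2)}_f=K^{(2)}_f/\tau$, and $p_2\colon|K^{(2)}_f|\to|\widetilde{K}^{(2)}_f|$ the induced double covering (a principal $S_2$-bundle). "Trivial" means trivial as a principal bundle (equivalently, admitting a continuous section). Definition of $\Gamma_f$. Assume $p_2$ is trivial. Let $\mathcal{C}$ be the set of connected components of $|K^{(2)}_f|$; $\tau$ induces a fixed-point free involution on $\mathcal{C}$. Let $O_1,\dots,O_n$ be the orbits of this involution. For each $i$ choose $C_i\in O_i$, so that $O_i=\{C_i,\tau(C_i)\}$; associate a boolean variable $x_i$ with $C_i$ and the literal $\neg x_i$ with $\tau(C_i)$. Thus each $C\in\mathcal{C}$ has an associated literal $\alpha_C$. Let $T$ be the set of ordered triples $(C,D,E)$ of connected components with $C\ne E$ and $D\neq E$ such that there exist three vertices $a,b,c\in V(K)$ with $(a,b)\in C$, $(b,c)\in D$, $(a,c)\in E$. Then $$\Gamma_f(x_1,\dots,x_n)=\bigwedge_{(C,D,E)\in T}\bigl((\alpha_C\wedge\alpha_D)\to\alpha_E\bigr)=\bigwedge_{(C,D,E)\in T}(\neg\alpha_C\vee\neg\alpha_D\vee\alpha_E).$$ Up to reordering clauses and literals and renaming variables, $\Gamma_f$ does not depend on the choice of representatives $C_i$. *)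

theory Defs
  imports "HOL-Analysis.Analysis"
begin

text \<open>Complexes are abstract; the empty set is not counted as a simplex. For realisations the
  vertices come from a finite type, which need not be exhausted by the vertex set; every finite
  complex is isomorphic to one of this form.\<close>

definition finite_complex :: "'v set set \<Rightarrow> bool" where
  "finite_complex K \<longleftrightarrow> finite K \<and> (\<forall>\<sigma>\<in>K. finite \<sigma> \<and> \<sigma> \<noteq> {}) \<and>
     (\<forall>\<sigma>\<in>K. \<forall>\<rho>. \<rho> \<subseteq> \<sigma> \<and> \<rho> \<noteq> {} \<longrightarrow> \<rho> \<in> K)"

definition vertices :: "'v set set \<Rightarrow> 'v set" where
  "vertices K = \<Union>K"

definition simplicial_map :: "'v set set \<Rightarrow> 'w set set \<Rightarrow> ('v \<Rightarrow> 'w) \<Rightarrow> bool" where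
  "simplicial_map K L f \<longleftrightarrow> (\<forall>\<sigma>\<in>K. f ` \<sigma> \<in> L)"

definition nondegenerate :: "'v set set \<Rightarrow> ('v \<Rightarrow> 'w) \<Rightarrow> bool" where
  "nondegenerate K f \<longleftrightarrow> (\<forall>\<sigma>\<in>K. inj_on f \<sigma>)"

definition vertex_point :: "'v::finite \<Rightarrow> real ^ 'v" where
  "vertex_point v = axis v 1"

definition realisation :: "'v::finite set set \<Rightarrow> (real ^ 'v) set" where
  "realisation K = (\<Union>\<sigma>\<in>K. convex hull (vertex_point ` \<sigma>))"

text \<open>The map induced by a vertex map: the linear extension of
  \<open>vertex_point v \<mapsto> vertex_point (f v)\<close>. Coordinates at non-vertices vanish on the realisation,
  so the values of \<open>f\<close> outside the vertex set are irrelevant there.\<close>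

definition induced_map :: "('v::finite \<Rightarrow> 'w::finite) \<Rightarrow> real ^ 'v \<Rightarrow> real ^ 'w" where
  "induced_map f x = (\<Sum>v\<in>UNIV. (x $ v) *\<^sub>R vertex_point (f v))"

definition piecewise_linear_on ::
    "'a::euclidean_space set \<Rightarrow> ('a \<Rightarrow> 'b::euclidean_space) \<Rightarrow> bool" where
  "piecewise_linear_on P \<phi> \<longleftrightarrow>
     (\<exists>\<T>. triangulation \<T> \<and> \<Union>\<T> = P \<and>
        (\<forall>S\<in>\<T>. \<exists>g c. linear g \<and> (\<forall>x\<in>S. \<phi> x = g x + c)))"

definition lifting :: "'a::euclidean_space set \<Rightarrow> 'b::euclidean_space set \<Rightarrow> ('a \<Rightarrow> 'b) \<Rightarrow>
    ('a \<Rightarrow> 'b \<times> real) \<Rightarrow> bool" where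
  "lifting P Q \<phi> g \<longleftrightarrow> g ` P \<subseteq> Q \<times> UNIV \<and> piecewise_linear_on P g \<and>
     embedding_map (top_of_set P) (top_of_set (Q \<times> UNIV)) g \<and> (\<forall>x\<in>P. fst (g x) = \<phi> x)"

definition lifts_to_embedding ::
    "'a::euclidean_space set \<Rightarrow> 'b::euclidean_space set \<Rightarrow> ('a \<Rightarrow> 'b) \<Rightarrow> bool" where
  "lifts_to_embedding P Q \<phi> \<longleftrightarrow> (\<exists>g. lifting P Q \<phi> g)"

definition isotopic_liftings :: "'a::euclidean_space set \<Rightarrow> 'b::euclidean_space set \<Rightarrow>
    ('a \<Rightarrow> 'b) \<Rightarrow> ('a \<Rightarrow> 'b \<times> real) \<Rightarrow> ('a \<Rightarrow> 'b \<times> real) \<Rightarrow> bool" where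
  "isotopic_liftings P Q \<phi> g h \<longleftrightarrow>
     homotopic_with (lifting P Q \<phi>) (top_of_set P) (top_of_set (Q \<times> UNIV)) g h"

text \<open>Liftings are total functions on the ambient space. Two of them which agree on \<open>P\<close> are
  isotopic (by a homotopy that jumps outside \<open>P\<close>), so the quotient does not see the values
  outside \<open>P\<close>.\<close>

definition isotopy_classes :: "'a::euclidean_space set \<Rightarrow> 'b::euclidean_space set \<Rightarrow>
    ('a \<Rightarrow> 'b) \<Rightarrow> ('a \<Rightarrow> 'b \<times> real) set set" where
  "isotopy_classes P Q \<phi> =
     {g. lifting P Q \<phi> g} // {(g, h). isotopic_liftings P Q \<phi> g h}"

definition double_vertices :: "'v set set \<Rightarrow> ('v \<Rightarrow> 'w) \<Rightarrow> ('v \<times> 'v) set" where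
  "double_vertices K f = {(u, v). u \<in> vertices K \<and> v \<in> vertices K \<and> u \<noteq> v \<and> f u = f v}"

text \<open>The cardinality conditions say that both projections of a \<open>k\<close>-simplex are again
  \<open>k\<close>-simplices, of the same dimension.\<close>

definition double_complex :: "'v set set \<Rightarrow> ('v \<Rightarrow> 'w) \<Rightarrow> ('v \<times> 'v) set set" where
  "double_complex K f = {S. S \<subseteq> double_vertices K f \<and> finite S \<and> S \<noteq> {} \<and>
     fst ` S \<in> K \<and> card (fst ` S) = card S \<and> snd ` S \<in> K \<and> card (snd ` S) = card S}"

definition tau :: "real ^ ('v::finite \<times> 'v) \<Rightarrow> real ^ ('v \<times> 'v)" where
  "tau = induced_map prod.swap"

definition quotient_topology :: "'a topology \<Rightarrow> ('a \<Rightarrow> 'b) \<Rightarrow> 'b topology" where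
  "quotient_topology X q =
     topology (\<lambda>U. U \<subseteq> q ` topspace X \<and> openin X {x \<in> topspace X. q x \<in> U})"

lemma openin_quotient_topology:
  "openin (quotient_topology X q) U \<longleftrightarrow>
     U \<subseteq> q ` topspace X \<and> openin X {x \<in> topspace X. q x \<in> U}"
proof -
  let ?P = "\<lambda>U. {x \<in> topspace X. q x \<in> U}"
  have "istopology (\<lambda>U. U \<subseteq> q ` topspace X \<and> openin X (?P U))"
    unfolding istopology_def
  proof (intro conjI allI impI)
    fix S T
    assume S: "S \<subseteq> q ` topspace X \<and> openin X (?P S)"
      and T: "T \<subseteq> q ` topspace X \<and> openin X (?P T)"
    have "openin X (?P S \<inter> ?P T)" using S T by (intro openin_Int) blast+
    moreover have "?P S \<inter> ?P T = ?P (S \<inter> T)" by blast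
    ultimately show "openin X (?P (S \<inter> T))" by (simp only:)
    show "S \<inter> T \<subseteq> q ` topspace X" using S by blast
  next
    fix \<K>
    assume K: "\<forall>S\<in>\<K>. S \<subseteq> q ` topspace X \<and> openin X (?P S)"
    have "openin X (\<Union>(?P ` \<K>))" using K by (intro openin_Union) blast
    moreover have "\<Union>(?P ` \<K>) = ?P (\<Union>\<K>)" by blast
    ultimately show "openin X (?P (\<Union>\<K>))" by (simp only:)
    show "\<Union>\<K> \<subseteq> q ` topspace X" using K by blast
  qed
  then show ?thesis
    unfolding quotient_topology_def by (simp only: topology_inverse')
qed

definition p2 :: "real ^ ('v::finite \<times> 'v) \<Rightarrow> (real ^ ('v \<times> 'v)) set" where
  "p2 x = {x, tau x}"

text \<open>The base of the covering is the topological quotient by \<open>tau\<close>, whose points are the orbits.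
  It is not defined through the set of vertex orbits, because distinct orbits of simplices may
  have the same vertex orbits.\<close>

definition double_quotient ::
    "'v::finite set set \<Rightarrow> ('v \<Rightarrow> 'w) \<Rightarrow> (real ^ ('v \<times> 'v)) set topology" where
  "double_quotient K f = quotient_topology (top_of_set (realisation (double_complex K f))) p2"

text \<open>Triviality as a principal bundle: an equivariant homeomorphism over the base with the
  product bundle, the group of order two acting on the discrete fibre \<open>bool\<close> by negation.\<close>

definition p2_trivial :: "'v::finite set set \<Rightarrow> ('v \<Rightarrow> 'w) \<Rightarrow> bool" where
  "p2_trivial K f \<longleftrightarrow>
     (\<exists>h. homeomorphic_map (top_of_set (realisation (double_complex K f)))
            (prod_topology (double_quotient K f) (discrete_topology (UNIV :: bool set))) h \<and>
          (\<forall>x\<in>realisation (double_complex K f).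
             fst (h x) = p2 x \<and> h (tau x) = (p2 x, \<not> snd (h x))))"

datatype 'x literal = Pos 'x | Neg 'x

fun negate :: "'x literal \<Rightarrow> 'x literal" where
  "negate (Pos x) = Neg x"
| "negate (Neg x) = Pos x"

fun literal_true :: "('x \<Rightarrow> bool) \<Rightarrow> 'x literal \<Rightarrow> bool" where
  "literal_true A (Pos x) \<longleftrightarrow> A x"
| "literal_true A (Neg x) \<longleftrightarrow> \<not> A x"

type_synonym 'x cnf = "'x literal set set"

definition satisfies :: "('x \<Rightarrow> bool) \<Rightarrow> 'x cnf \<Rightarrow> bool" where
  "satisfies A \<Gamma> \<longleftrightarrow> (\<forall>cl\<in>\<Gamma>. \<exists>l\<in>cl. literal_true A l)"

definition satisfiable :: "'x cnf \<Rightarrow> bool" where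
  "satisfiable \<Gamma> \<longleftrightarrow> (\<exists>A. satisfies A \<Gamma>)"

definition double_components ::
    "'v::finite set set \<Rightarrow> ('v \<Rightarrow> 'w) \<Rightarrow> (real ^ ('v \<times> 'v)) set set" where
  "double_components K f = components (realisation (double_complex K f))"

definition component_orbits ::
    "'v::finite set set \<Rightarrow> ('v \<Rightarrow> 'w) \<Rightarrow> (real ^ ('v \<times> 'v)) set set set" where
  "component_orbits K f = (\<lambda>C. {C, tau ` C}) ` double_components K f"

text \<open>\<open>R\<close> is the set of the chosen components, one from each orbit. The boolean variable
  associated with an orbit is named by its representative in \<open>R\<close>. The involution on components
  is fixed-point free only when \<open>p2\<close> is trivial; the definition makes sense in any case.\<close>

definition orbit_representatives ::
    "'v::finite set set \<Rightarrow> ('v \<Rightarrow> 'w) \<Rightarrow> (real ^ ('v \<times> 'v)) set set \<Rightarrow> bool" where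
  "orbit_representatives K f R \<longleftrightarrow>
     R \<subseteq> double_components K f \<and> (\<forall>Orb\<in>component_orbits K f. \<exists>!C. C \<in> Orb \<and> C \<in> R)"

lemma tau_tau:
  fixes x :: "real ^ ('v::finite \<times> 'v)"
  shows "tau (tau x) = x"
proof -
  have "tau y $ p = y $ prod.swap p" for y :: "real ^ ('v \<times> 'v)" and p
  proof -
    have "axis (prod.swap v) (1::real) $ p = (if v = prod.swap p then 1 else 0)" for v
      by (cases v; cases p) (auto simp: axis_def)
    then have "tau y $ p = (\<Sum>v\<in>UNIV. y $ v * (if v = prod.swap p then 1 else 0))"
      unfolding tau_def induced_map_def vertex_point_def by (simp only: sum_component vector_scaleR_component real_scaleR_def)
    also have "\<dots> = y $ prod.swap p" by (simp add: if_distrib cong: if_cong)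
    finally show ?thesis .
  qed
  then show ?thesis by (simp add: vec_eq_iff)
qed

lemma orbit_representatives_exist:
  fixes K :: "'v::finite set set" and f :: "'v \<Rightarrow> 'w"
  shows "\<exists>R. orbit_representatives K f R"
proof -
  let ?orb = "\<lambda>C. {C, tau ` C}"
  define r where "r Orb = (SOME C. C \<in> Orb \<and> C \<in> double_components K f)" for Orb
  let ?R = "r ` component_orbits K f"
  have r: "r Orb \<in> Orb \<and> r Orb \<in> double_components K f" if O: "Orb \<in> component_orbits K f" for Orb
  proof -
    obtain C where "Orb = ?orb C" "C \<in> double_components K f"
      using O unfolding component_orbits_def by blast
    then have "C \<in> Orb \<and> C \<in> double_components K f" by blast
    then show ?thesis unfolding r_def by (rule someI)
  qed
  have tt: "tau ` tau ` C = C" for C :: "(real ^ ('v \<times> 'v)) set"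
    by (simp only: image_image tau_tau image_ident)
  have eq: "Orb = ?orb C" if O: "Orb \<in> component_orbits K f" "C \<in> Orb" for Orb C
  proof -
    obtain D where D: "Orb = ?orb D" using O(1) unfolding component_orbits_def by blast
    then consider "C = D" | "C = tau ` D" using O(2) by blast
    then show ?thesis
    proof cases
      case 1
      then show ?thesis by (simp only: D)
    next
      case 2
      then have "?orb C = {tau ` D, D}" by (simp only: tt)
      then show ?thesis by (simp only: D insert_commute)
    qed
  qed
  have "\<exists>!C. C \<in> Orb \<and> C \<in> ?R" if O: "Orb \<in> component_orbits K f" for Orb
  proof (rule ex1I[of _ "r Orb"])
    show "r Orb \<in> Orb \<and> r Orb \<in> ?R" using r[OF O] O by blast
    fix C assume C: "C \<in> Orb \<and> C \<in> ?R"
    then obtain O' where O': "O' \<in> component_orbits K f" "C = r O'" by blast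
    have "C \<in> O'" using r[OF O'(1)] unfolding O'(2) by (rule conjunct1)
    then have "O' = ?orb C" by (rule eq[OF O'(1)])
    also have "?orb C = Orb" using C by (intro eq[OF O, symmetric]) (rule conjunct1)
    finally show "C = r Orb" unfolding O'(2) by (rule arg_cong)
  qed
  moreover have "?R \<subseteq> double_components K f"
    by (rule image_subsetI) (rule conjunct2[OF r])
  ultimately show ?thesis unfolding orbit_representatives_def by (intro exI[of _ ?R] conjI ballI)
qed

definition component_literal :: "(real ^ ('v::finite \<times> 'v)) set set \<Rightarrow>
    (real ^ ('v \<times> 'v)) set \<Rightarrow> (real ^ ('v \<times> 'v)) set literal" where
  "component_literal R C = (if C \<in> R then Pos C else Neg (tau ` C))"

definition transitivity_triples :: "'v::finite set set \<Rightarrow> ('v \<Rightarrow> 'w) \<Rightarrow>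
    ((real ^ ('v \<times> 'v)) set \<times> (real ^ ('v \<times> 'v)) set \<times> (real ^ ('v \<times> 'v)) set) set" where
  "transitivity_triples K f = {(C, D, E).
     C \<in> double_components K f \<and> D \<in> double_components K f \<and> E \<in> double_components K f \<and>
     C \<noteq> E \<and> D \<noteq> E \<and>
     (\<exists>a\<in>vertices K. \<exists>b\<in>vertices K. \<exists>c\<in>vertices K.
        vertex_point (a, b) \<in> C \<and> vertex_point (b, c) \<in> D \<and> vertex_point (a, c) \<in> E)}"

definition Gamma_formula :: "'v::finite set set \<Rightarrow> ('v \<Rightarrow> 'w) \<Rightarrow>
    (real ^ ('v \<times> 'v)) set set \<Rightarrow> (real ^ ('v \<times> 'v)) set cnf" where
  "Gamma_formula K f R =
     (\<lambda>(C, D, E). {negate (component_literal R C), negate (component_literal R D),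
                    component_literal R E}) ` transitivity_triples K f"

text \<open>Assignments of the variables in \<open>R\<close>, as functions fixed outside \<open>R\<close>.\<close>

definition satisfying_assignments :: "'v::finite set set \<Rightarrow> ('v \<Rightarrow> 'w) \<Rightarrow>
    (real ^ ('v \<times> 'v)) set set \<Rightarrow> ((real ^ ('v \<times> 'v)) set \<Rightarrow> bool) set" where
  "satisfying_assignments K f R =
     {A \<in> R \<rightarrow>\<^sub>E (UNIV :: bool set). satisfies A (Gamma_formula K f R)}"

end

theory Submission
  imports Defs
begin

text \<open>A lifting of \<open>|f|\<close> is the same thing as a piecewise linear height function \<open>k\<close> on \<open>|K|\<close> that takes
  different values at any two different points \<open>x\<close>, \<open>y\<close> with the same image. At such a pair of points
  the carriers of \<open>x\<close> and \<open>y\<close> are simplices with the same image, and \<open>f\<close> matches their vertices one to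
  one, with equal barycentric coordinates. The matched pairs \<open>(v, u)\<close> with \<open>v \<noteq> u\<close> form a simplex of the
  double complex, and the pair \<open>(x, y)\<close> can be moved linearly to the pair of vertex points of any one of
  them without leaving the set of double points (\<open>double_point_segment\<close>). Since \<open>k(y) - k(x)\<close> never
  vanishes, its sign at every double point is therefore dictated by the order that \<open>k\<close> induces on the
  vertices in each fibre of \<open>f\<close> (\<open>separating_sign\<close>).

  \<^bold>\<open>From liftings to assignments.\<close> The function \<open>k(pr\<^sub>2 z) - k(pr\<^sub>1 z)\<close> on the realisation of the double
  complex is continuous, odd under \<open>tau\<close> and without zeros. Its sign trivialises the covering
  (\<open>p2_trivialI\<close>), and it is constant on components, so that it is an assignment of truth values to
  them. This assignment satisfies the formula because the order of the real numbers is transitive.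

  \<^bold>\<open>From assignments to liftings.\<close> If the covering is trivial, no component is invariant under \<open>tau\<close>
  (\<open>tau_double_component_neq\<close>), so every assignment orients each pair of different vertices in a common
  fibre; the clauses say that this orientation is transitive (\<open>order_of_trans\<close>). It is thus a linear order
  on each fibre. Any vertex heights that increase along these orders, extended linearly over \<open>|K|\<close>,
  give a lifting: the difference of the heights of a double point is a positive combination of the
  differences over one simplex of the double complex, and these have a common sign because a simplex is
  connected (\<open>separating_linear_height\<close>).

  \<^bold>\<open>Isotopy classes.\<close> Along an isotopy the sign at a pair of vertices cannot change. Conversely, every
  lifting is joined by a straight line to the linear lifting that induces the same orders on the fibres:
  their height differences have equal signs at every double point, hence so have all convex combinations
  (\<open>isotopic_linear_lift\<close>). So liftings up to isotopy are classified by the induced orders, that is, by the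
  satisfying assignments.\<close>

section \<open>Barycentric coordinates\<close>

definition support :: "real ^ 'v::finite \<Rightarrow> 'v set" where
  "support x = {v. x $ v \<noteq> 0}"

lemma vertex_point_nth: "vertex_point v $ u = (if u = v then 1 else 0)"
  by (simp add: vertex_point_def axis_def)

lemma support_vertex_point: "support (vertex_point v) = {v}"
  by (auto simp: support_def vertex_point_nth)

lemma inj_vertex_point: "inj vertex_point"
  by (rule injI) (metis support_vertex_point singleton_inject)

lemma sum_vertex_point: "(\<Sum>v\<in>UNIV. x $ v *\<^sub>R vertex_point v) = x"
  by (simp add: vec_eq_iff vertex_point_nth if_distrib cong: if_cong)

text \<open>The vertex points are a basis, so barycentric coordinates are plain coordinates. This turns all later
  questions about carriers of points into questions about supports.\<close>

lemma convex_hull_vertex_points: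
  fixes \<sigma> :: "'v::finite set"
  shows "convex hull (vertex_point ` \<sigma>) =
    {x. (\<forall>v. 0 \<le> x $ v) \<and> (\<Sum>v\<in>UNIV. x $ v) = 1 \<and> support x \<subseteq> \<sigma>}" (is "_ = ?S")
proof
  have "convex ?S"
  proof (rule convexI)
    fix x y :: "real ^ 'v" and s t :: real
    assume xy: "x \<in> ?S" "y \<in> ?S" and st: "0 \<le> s" "0 \<le> t" "s + t = 1"
    have "(\<Sum>v\<in>UNIV. (s *\<^sub>R x + t *\<^sub>R y) $ v) = 1"
      using xy st by (simp add: sum.distrib flip: sum_distrib_left)
    moreover have "support (s *\<^sub>R x + t *\<^sub>R y) \<subseteq> support x \<union> support y"
      by (auto simp: support_def)
    moreover have "0 \<le> (s *\<^sub>R x + t *\<^sub>R y) $ v" for v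
      using xy st by simp
    moreover have "support x \<union> support y \<subseteq> \<sigma>"
      using xy by blast
    ultimately show "s *\<^sub>R x + t *\<^sub>R y \<in> ?S"
      by blast
  qed
  moreover have "vertex_point ` \<sigma> \<subseteq> ?S"
    by (auto simp: support_vertex_point vertex_point_nth)
  ultimately show "convex hull (vertex_point ` \<sigma>) \<subseteq> ?S"
    by (intro hull_minimal)
  show "?S \<subseteq> convex hull (vertex_point ` \<sigma>)"
  proof
    fix x assume x: "x \<in> ?S"
    have zero: "x $ v = 0" if "v \<notin> \<sigma>" for v
      using x that by (auto simp: support_def)
    have "(\<Sum>v\<in>\<sigma>. x $ v) = (\<Sum>v\<in>UNIV. x $ v)"
      by (rule sum.mono_neutral_left) (auto simp: zero)
    then have "(\<Sum>v\<in>\<sigma>. x $ v) = 1"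
      using x by simp
    then have "(\<Sum>v\<in>\<sigma>. x $ v *\<^sub>R vertex_point v) \<in> convex hull (vertex_point ` \<sigma>)"
      using x by (intro convex_sum) (simp_all add: hull_inc)
    moreover have "(\<Sum>v\<in>\<sigma>. x $ v *\<^sub>R vertex_point v) = (\<Sum>v\<in>UNIV. x $ v *\<^sub>R vertex_point v)"
      by (rule sum.mono_neutral_left) (auto simp: zero)
    ultimately show "x \<in> convex hull (vertex_point ` \<sigma>)"
      by (simp add: sum_vertex_point)
  qed
qed

lemma support_nonempty:
  assumes "(\<Sum>v\<in>UNIV. x $ v) = 1"
  shows "support x \<noteq> {}"
proof
  assume "support x = {}"
  then have "x $ v = 0" for v
    unfolding support_def by blast
  then have "(\<Sum>v\<in>UNIV. x $ v) = 0"
    by (rule sum.neutral[OF ballI])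
  with assms show False
    by simp
qed

lemma face_in_complex:
  assumes "finite_complex K" "\<sigma> \<in> K" "\<rho> \<subseteq> \<sigma>" "\<rho> \<noteq> {}"
  shows "\<rho> \<in> K"
  using assms unfolding finite_complex_def by blast

lemma mem_realisation:
  assumes "finite_complex K"
  shows "x \<in> realisation K \<longleftrightarrow>
    (\<forall>v. 0 \<le> x $ v) \<and> (\<Sum>v\<in>UNIV. x $ v) = 1 \<and> support x \<in> K"
proof
  assume "x \<in> realisation K"
  then obtain \<sigma> where \<sigma>: "\<sigma> \<in> K" "x \<in> convex hull (vertex_point ` \<sigma>)"
    unfolding realisation_def by blast
  then have x: "\<forall>v. 0 \<le> x $ v" "(\<Sum>v\<in>UNIV. x $ v) = 1" "support x \<subseteq> \<sigma>"
    by (simp_all add: convex_hull_vertex_points)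
  moreover have "support x \<in> K"
    by (rule face_in_complex[OF assms \<sigma>(1) x(3) support_nonempty[OF x(2)]])
  ultimately show "(\<forall>v. 0 \<le> x $ v) \<and> (\<Sum>v\<in>UNIV. x $ v) = 1 \<and> support x \<in> K"
    by (intro conjI)
next
  assume x: "(\<forall>v. 0 \<le> x $ v) \<and> (\<Sum>v\<in>UNIV. x $ v) = 1 \<and> support x \<in> K"
  then have "x \<in> convex hull (vertex_point ` support x)"
    by (simp add: convex_hull_vertex_points)
  with x show "x \<in> realisation K"
    unfolding realisation_def by (intro UN_I[of "support x"]) simp_all
qed

lemma support_subset_vertices:
  assumes "finite_complex K" "x \<in> realisation K"
  shows "support x \<subseteq> vertices K"
  using assms(2) unfolding mem_realisation[OF assms(1)] vertices_def by (intro Union_upper) simp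

lemma singleton_in_complex:
  assumes "finite_complex K" "v \<in> vertices K"
  shows "{v} \<in> K"
proof -
  obtain \<sigma> where "\<sigma> \<in> K" "v \<in> \<sigma>"
    using assms(2) by (auto simp: vertices_def)
  then show ?thesis
    using face_in_complex[OF assms(1), of \<sigma> "{v}"] by simp
qed

lemma vertex_point_in_realisation:
  assumes "finite_complex K"
  shows "vertex_point v \<in> realisation K \<longleftrightarrow> v \<in> vertices K"
proof -
  have "vertex_point v \<in> realisation K \<longleftrightarrow> {v} \<in> K"
    by (simp add: mem_realisation[OF assms] support_vertex_point vertex_point_nth)
  then show ?thesis
    using singleton_in_complex[OF assms] unfolding vertices_def by blast
qed

lemma compact_realisation:
  assumes "finite_complex K"
  shows "compact (realisation K)"
  unfolding realisation_def using assms
  by (intro compact_UN compact_convex_hull finite_imp_compact) (simp_all add: finite_complex_def)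

lemma closed_segment_in_realisation:
  assumes K: "finite_complex K" and x: "x \<in> realisation K" and v: "v \<in> support x"
  shows "closed_segment x (vertex_point v) \<subseteq> realisation K"
proof -
  have "x \<in> convex hull (vertex_point ` support x)"
    using x by (simp add: mem_realisation[OF K] convex_hull_vertex_points)
  moreover have "vertex_point v \<in> convex hull (vertex_point ` support x)"
    using v by (simp add: hull_inc)
  ultimately have "closed_segment x (vertex_point v) \<subseteq> convex hull (vertex_point ` support x)"
    by (rule closed_segment_subset[OF _ _ convex_convex_hull])
  moreover have "support x \<in> K"
    using x by (simp add: mem_realisation[OF K])
  ultimately show ?thesis
    unfolding realisation_def by blast
qed

lemma affine_independent_vertex_points: "\<not> affine_dependent (vertex_point ` \<sigma>)"
proof -
  have "vertex_point ` \<sigma> \<subseteq> Basis"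
    by (auto simp: vertex_point_def axis_in_Basis_iff)
  then have "independent (vertex_point ` \<sigma>)"
    using independent_Basis independent_mono by blast
  then show ?thesis
    using affine_dependent_imp_dependent by blast
qed

text \<open>Two simplices meet in the hull of their common vertices, which is a face of both since vertex points
  are affinely independent. The intersection may be empty, and the empty set counts as a face.\<close>

lemma triangulation_realisation:
  fixes K :: "'v::finite set set"
  assumes K: "finite_complex K"
  shows "triangulation ((\<lambda>\<sigma>. convex hull (vertex_point ` \<sigma>)) ` K)"
  unfolding triangulation_def
proof (intro conjI ballI allI impI)
  show "finite ((\<lambda>\<sigma>. convex hull (vertex_point ` \<sigma>)) ` K)"
    using K by (simp add: finite_complex_def)
next
  fix T :: "(real ^ 'v) set"
  assume "T \<in> (\<lambda>\<sigma>. convex hull (vertex_point ` \<sigma>)) ` K"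
  then obtain \<sigma> :: "'v set" where "T = convex hull (vertex_point ` \<sigma>)"
    by blast
  then have "(int (card (vertex_point ` \<sigma>)) - 1) simplex T"
    unfolding simplex_def
    by (intro exI[of _ "vertex_point ` \<sigma>"]) (simp add: affine_independent_vertex_points)
  then show "\<exists>n. n simplex T" ..
next
  fix T T' :: "(real ^ 'v) set"
  assume "T \<in> (\<lambda>\<sigma>. convex hull (vertex_point ` \<sigma>)) ` K \<and>
    T' \<in> (\<lambda>\<sigma>. convex hull (vertex_point ` \<sigma>)) ` K"
  then obtain \<sigma> \<rho> where T: "T = convex hull (vertex_point ` \<sigma>)" "T' = convex hull (vertex_point ` \<rho>)"
    by blast
  have "T \<inter> T' = convex hull (vertex_point ` (\<sigma> \<inter> \<rho>))"
    unfolding T convex_hull_vertex_points by blast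
  moreover have "\<dots> face_of T"
    unfolding T face_of_convex_hull_affine_independent[OF affine_independent_vertex_points]
    by (intro exI[of _ "vertex_point ` (\<sigma> \<inter> \<rho>)"]) auto
  ultimately show "T \<inter> T' face_of T"
    by (simp only:)
qed

section \<open>Induced maps\<close>

lemma induced_map_nth: "induced_map f x $ w = (\<Sum>v | f v = w. x $ v)"
proof -
  have "induced_map f x $ w = (\<Sum>v\<in>UNIV. if f v = w then x $ v else 0)"
    unfolding induced_map_def
    by (simp add: vertex_point_nth if_distrib eq_commute[of w] cong: if_cong)
  then show ?thesis
    by (simp add: sum.If_cases)
qed

lemma linear_induced_map: "linear (induced_map f)"
  unfolding induced_map_def
  by (rule linearI) (simp_all add: scaleR_add_left sum.distrib scaleR_sum_right)

lemma induced_map_vertex_point: "induced_map f (vertex_point v) = vertex_point (f v)"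
  by (auto simp: vec_eq_iff induced_map_nth vertex_point_nth)

lemma induced_map_comp: "induced_map g (induced_map f x) = induced_map (g \<circ> f) x"
  unfolding induced_map_def[of f] induced_map_def[of "g \<circ> f"]
  by (simp add: linear_sum[OF linear_induced_map] linear_scale[OF linear_induced_map]
      induced_map_vertex_point)

lemma induced_map_cong:
  assumes "\<And>v. v \<in> support x \<Longrightarrow> f v = g v"
  shows "induced_map f x = induced_map g x"
  unfolding induced_map_def using assms by (intro sum.cong) (auto simp: support_def)

text \<open>Nonnegative coordinates cannot cancel when they are added up over a fibre.\<close>

lemma support_induced_map:
  assumes "\<And>v. 0 \<le> x $ v"
  shows "support (induced_map f x) = f ` support x"
  using assms by (auto simp: support_def induced_map_nth sum_nonneg_eq_0_iff)

lemma induced_map_in_realisation: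
  fixes K :: "'v::finite set set" and L :: "'w::finite set set"
  assumes K: "finite_complex K" and L: "finite_complex L" and f: "\<And>\<sigma>. \<sigma> \<in> K \<Longrightarrow> f ` \<sigma> \<in> L"
    and x: "x \<in> realisation K"
  shows "induced_map f x \<in> realisation L"
proof -
  have x': "\<And>v. 0 \<le> x $ v" "(\<Sum>v\<in>UNIV. x $ v) = 1" "support x \<in> K"
    using x by (simp_all add: mem_realisation[OF K])
  have "(\<Sum>w\<in>UNIV. induced_map f x $ w) = 1"
    unfolding induced_map_nth using sum.group[of UNIV UNIV f "\<lambda>v. x $ v"] x'(2) by simp
  then show ?thesis
    using x' f by (simp add: mem_realisation[OF L] support_induced_map)
      (simp add: induced_map_nth sum_nonneg)
qed

section \<open>Double points\<close>

locale nondegenerate_simplicial_map =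
  fixes K :: "'v::finite set set" and L :: "'w::finite set set" and f :: "'v \<Rightarrow> 'w"
  assumes complex_K: "finite_complex K" and complex_L: "finite_complex L"
    and simplicial: "simplicial_map K L f" and nondegenerate: "nondegenerate K f"
begin

lemma image_in_L: "\<sigma> \<in> K \<Longrightarrow> f ` \<sigma> \<in> L"
  using simplicial by (simp add: simplicial_map_def)

lemma inj_on_support:
  assumes "x \<in> realisation K"
  shows "inj_on f (support x)"
  using assms nondegenerate by (simp add: nondegenerate_def mem_realisation[OF complex_K])

text \<open>Non-degeneracy means that the carrier of \<open>x\<close> meets every fibre at most once, so that \<open>|f|\<close> merely
  relabels the coordinates of \<open>x\<close>.\<close>

lemma coordinate_at_image:
  assumes x: "x \<in> realisation K" and v: "v \<in> support x"
  shows "induced_map f x $ f v = x $ v"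
proof -
  have "x $ u = 0" if "f u = f v" "u \<noteq> v" for u
    using inj_onD[OF inj_on_support[OF x] that(1) _ v] that(2) by (auto simp: support_def)
  then have "(\<Sum>u | f u = f v. x $ u) = (\<Sum>u\<in>{v}. x $ u)"
    by (intro sum.mono_neutral_right) auto
  then show ?thesis
    by (simp add: induced_map_nth)
qed

definition double_point :: "real ^ 'v \<Rightarrow> real ^ 'v \<Rightarrow> bool" where
  "double_point x y \<longleftrightarrow> x \<in> realisation K \<and> y \<in> realisation K \<and> x \<noteq> y \<and>
     induced_map f x = induced_map f y"

lemma double_point_vertex_points:
  "(v, u) \<in> double_vertices K f \<Longrightarrow> double_point (vertex_point v) (vertex_point u)"
  by (auto simp: double_point_def double_vertices_def vertex_point_in_realisation[OF complex_K]
      induced_map_vertex_point dest: injD[OF inj_vertex_point])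

text \<open>The matched pairs of vertices of the carriers of a double point, and among them those pairs which are
  vertices of the double complex.\<close>

definition matching :: "real ^ 'v \<Rightarrow> real ^ 'v \<Rightarrow> ('v \<times> 'v) set" where
  "matching x y = {(v, u). v \<in> support x \<and> u \<in> support y \<and> f v = f u}"

definition moved :: "real ^ 'v \<Rightarrow> real ^ 'v \<Rightarrow> ('v \<times> 'v) set" where
  "moved x y = {(v, u) \<in> matching x y. v \<noteq> u}"

lemma matching_coordinate:
  assumes "double_point x y" "p \<in> matching x y"
  shows "x $ fst p = y $ snd p"
proof -
  obtain v u where p: "p = (v, u)" "v \<in> support x" "u \<in> support y" "f v = f u"
    using assms(2) by (auto simp: matching_def)
  then show ?thesis
    using assms(1) coordinate_at_image[of x v] coordinate_at_image[of y u]
    by (simp add: double_point_def)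
qed

lemma image_support_eq:
  assumes "double_point x y"
  shows "f ` support x = f ` support y"
proof -
  have "support (induced_map f z) = f ` support z" if "z \<in> realisation K" for z
    using that by (intro support_induced_map) (simp add: mem_realisation[OF complex_K])
  then show ?thesis
    using assms unfolding double_point_def by metis
qed

lemma matching_fst:
  assumes "double_point x y"
  shows "bij_betw fst (matching x y) (support x)"
proof (rule bij_betw_imageI)
  have "inj_on f (support y)"
    using assms by (simp add: double_point_def inj_on_support)
  then show "inj_on fst (matching x y)"
    by (auto simp: inj_on_def matching_def)
  show "fst ` matching x y = support x"
    using image_support_eq[OF assms] by (force simp: matching_def)
qed

lemma matching_snd:
  assumes "double_point x y"
  shows "bij_betw snd (matching x y) (support y)"
proof (rule bij_betw_imageI)
  have "inj_on f (support x)"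
    using assms by (simp add: double_point_def inj_on_support)
  then show "inj_on snd (matching x y)"
    by (auto simp: inj_on_def matching_def)
  show "snd ` matching x y = support y"
    using image_support_eq[OF assms] by (force simp: matching_def)
qed

text \<open>If all matched vertices agreed, the two points would have the same coordinates.\<close>

lemma moved_nonempty:
  assumes "double_point x y"
  shows "moved x y \<noteq> {}"
proof
  assume none: "moved x y = {}"
  then have diag: "fst p = snd p" if "p \<in> matching x y" for p
    using that by (auto simp: moved_def)
  have "x $ v = y $ v" for v
  proof (cases "v \<in> support x \<or> v \<in> support y")
    case True
    then obtain p where p: "p \<in> matching x y" "v = fst p \<or> v = snd p"
      using bij_betw_imp_surj_on[OF matching_fst[OF assms]]
        bij_betw_imp_surj_on[OF matching_snd[OF assms]] by blast
    then show ?thesis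
      using matching_coordinate[OF assms p(1)] diag[OF p(1)] by auto
  next
    case False
    then show ?thesis
      by (simp add: support_def)
  qed
  then show False
    using assms by (simp add: double_point_def vec_eq_iff)
qed

lemma moved_in_double_complex:
  assumes "double_point x y"
  shows "moved x y \<in> double_complex K f"
proof -
  have sub: "moved x y \<subseteq> matching x y"
    by (auto simp: moved_def)
  have x: "x \<in> realisation K" "support x \<in> K" and y: "y \<in> realisation K" "support y \<in> K"
    using assms by (simp_all add: double_point_def mem_realisation[OF complex_K])
  have inj: "inj_on fst (moved x y)" "inj_on snd (moved x y)"
    using matching_fst[OF assms] matching_snd[OF assms] sub
    by (auto simp: bij_betw_def intro: inj_on_subset)
  have "fst ` moved x y \<in> K"
    by (rule face_in_complex[OF complex_K x(2)])
      (use moved_nonempty[OF assms] in \<open>auto simp: moved_def matching_def\<close>)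
  moreover have "snd ` moved x y \<in> K"
    by (rule face_in_complex[OF complex_K y(2)])
      (use moved_nonempty[OF assms] in \<open>auto simp: moved_def matching_def\<close>)
  moreover have "moved x y \<subseteq> double_vertices K f"
    using support_subset_vertices[OF complex_K x(1)] support_subset_vertices[OF complex_K y(1)]
    by (auto simp: moved_def matching_def double_vertices_def)
  ultimately show ?thesis
    using moved_nonempty[OF assms] by (simp add: double_complex_def card_image inj)
qed

text \<open>Both sums can be taken over the matching, along which the coordinates of \<open>x\<close> and \<open>y\<close> agree; the
  vertices common to both carriers then cancel.\<close>

lemma height_difference:
  fixes c :: "'v \<Rightarrow> real"
  assumes xy: "double_point x y"
  shows "(\<Sum>v\<in>UNIV. y $ v * c v) - (\<Sum>v\<in>UNIV. x $ v * c v) =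
    (\<Sum>p\<in>moved x y. x $ fst p * (c (snd p) - c (fst p)))"
proof -
  have supp: "(\<Sum>v\<in>UNIV. z $ v * c v) = (\<Sum>v\<in>support z. z $ v * c v)" for z :: "real ^ 'v"
    by (rule sum.mono_neutral_right) (auto simp: support_def)
  have "(\<Sum>v\<in>UNIV. y $ v * c v) = (\<Sum>p\<in>matching x y. y $ snd p * c (snd p))"
    unfolding supp using sum.reindex_bij_betw[OF matching_snd[OF xy], of "\<lambda>v. y $ v * c v"]
    by simp
  also have "\<dots> = (\<Sum>p\<in>matching x y. x $ fst p * c (snd p))"
    by (intro sum.cong) (simp_all add: matching_coordinate[OF xy])
  finally have y: "(\<Sum>v\<in>UNIV. y $ v * c v) = (\<Sum>p\<in>matching x y. x $ fst p * c (snd p))" .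
  have x: "(\<Sum>v\<in>UNIV. x $ v * c v) = (\<Sum>p\<in>matching x y. x $ fst p * c (fst p))"
    unfolding supp using sum.reindex_bij_betw[OF matching_fst[OF xy], of "\<lambda>v. x $ v * c v"]
    by simp
  have "(\<Sum>v\<in>UNIV. y $ v * c v) - (\<Sum>v\<in>UNIV. x $ v * c v) =
      (\<Sum>p\<in>matching x y. x $ fst p * (c (snd p) - c (fst p)))"
    unfolding x y by (simp add: right_diff_distrib sum_subtractf)
  also have "\<dots> = (\<Sum>p\<in>moved x y. x $ fst p * (c (snd p) - c (fst p)))"
    by (rule sum.mono_neutral_right) (auto simp: moved_def)
  finally show ?thesis .
qed

text \<open>The first point stays the only one of the two with a positive coordinate at \<open>v\<close>, since the carrier of
  \<open>y\<close> meets the fibre through \<open>v\<close> in \<open>u\<close> alone. So a double point can be contracted to any vertex of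
  its simplex of moved pairs; this takes the place of a retraction onto the double complex.\<close>

lemma double_point_segment:
  assumes xy: "double_point x y" and p: "(v, u) \<in> moved x y" and s: "0 \<le> s" "s \<le> 1"
  shows "double_point ((1 - s) *\<^sub>R x + s *\<^sub>R vertex_point v) ((1 - s) *\<^sub>R y + s *\<^sub>R vertex_point u)"
    (is "double_point ?x ?y")
proof -
  have vu: "v \<in> support x" "u \<in> support y" "f v = f u" "v \<noteq> u"
    using p by (auto simp: moved_def matching_def)
  have x: "x \<in> realisation K" and y: "y \<in> realisation K" and f: "induced_map f x = induced_map f y"
    using xy by (auto simp: double_point_def)
  have "?x \<in> realisation K" "?y \<in> realisation K"
    using closed_segment_in_realisation[OF complex_K x vu(1)]
      closed_segment_in_realisation[OF complex_K y vu(2)] s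
    unfolding closed_segment_def by blast+
  moreover have "induced_map f ?x = induced_map f ?y"
    by (simp add: linear_add[OF linear_induced_map] linear_scale[OF linear_induced_map]
        induced_map_vertex_point f vu(3))
  moreover have "?x \<noteq> ?y"
  proof -
    have "v \<notin> support y"
      using inj_onD[OF inj_on_support[OF y] vu(3) _ vu(2)] vu(4) by blast
    then have "?y $ v = 0"
      using vu(4) by (simp add: support_def vertex_point_nth)
    moreover have "?x $ v > 0"
    proof -
      have "x $ v > 0"
        using x vu(1) by (simp add: mem_realisation[OF complex_K] support_def order_less_le)
      then show ?thesis
        using s by (cases "s = 1") (auto simp: vertex_point_nth intro!: add_pos_nonneg)
    qed
    ultimately show ?thesis
      by force
  qed
  ultimately show ?thesis
    by (simp add: double_point_def)
qed

section \<open>The double complex\<close>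

abbreviation double_space :: "(real ^ ('v \<times> 'v)) set" where
  "double_space \<equiv> realisation (double_complex K f)"

lemma complex_double: "finite_complex (double_complex K f)"
  unfolding finite_complex_def
proof (intro conjI ballI allI impI)
  fix S T
  assume S: "S \<in> double_complex K f" and T: "T \<subseteq> S \<and> T \<noteq> {}"
  then have "inj_on fst S" "inj_on snd S"
    by (simp_all add: double_complex_def eq_card_imp_inj_on)
  then have "inj_on fst T" "inj_on snd T"
    using T by (auto intro: inj_on_subset)
  moreover have "fst ` T \<in> K"
    by (rule face_in_complex[OF complex_K, of "fst ` S"])
      (use S T in \<open>auto simp: double_complex_def\<close>)
  moreover have "snd ` T \<in> K"
    by (rule face_in_complex[OF complex_K, of "snd ` S"])
      (use S T in \<open>auto simp: double_complex_def\<close>)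
  ultimately show "T \<in> double_complex K f"
    using S T by (auto simp: double_complex_def card_image)
qed (auto simp: double_complex_def)

lemma vertices_double_complex: "vertices (double_complex K f) = double_vertices K f"
proof
  show "vertices (double_complex K f) \<subseteq> double_vertices K f"
    by (auto simp: vertices_def double_complex_def)
  show "double_vertices K f \<subseteq> vertices (double_complex K f)"
  proof
    fix p assume "p \<in> double_vertices K f"
    moreover from this have "{p} \<in> double_complex K f"
      using singleton_in_complex[OF complex_K]
      by (auto simp: double_complex_def double_vertices_def)
    ultimately show "p \<in> vertices (double_complex K f)"
      by (auto simp: vertices_def)
  qed
qed

lemma vertex_point_in_double_space:
  "vertex_point p \<in> double_space \<longleftrightarrow> p \<in> double_vertices K f"
  by (simp add: vertex_point_in_realisation[OF complex_double] vertices_double_complex)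

text \<open>Each point of the double space gives two points of \<open>|K|\<close> with the same image and disjoint carriers.\<close>

lemma double_point_projections:
  assumes z: "z \<in> double_space"
  shows "double_point (induced_map fst z) (induced_map snd z)"
proof -
  let ?S = "support z"
  have z': "\<And>p. 0 \<le> z $ p" "?S \<in> double_complex K f"
    using z unfolding mem_realisation[OF complex_double] by blast+
  then have S: "fst ` ?S \<in> K" "snd ` ?S \<in> K" "?S \<subseteq> double_vertices K f" "?S \<noteq> {}"
      "inj_on snd ?S"
    by (simp_all add: double_complex_def eq_card_imp_inj_on)
  have in_K: "induced_map fst z \<in> realisation K" "induced_map snd z \<in> realisation K"
    by (rule induced_map_in_realisation[OF complex_double complex_K _ z];
        simp add: double_complex_def)+
  have "induced_map f (induced_map fst z) = induced_map f (induced_map snd z)"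
    unfolding induced_map_comp using S(3)
    by (intro induced_map_cong) (auto simp: double_vertices_def)
  moreover have "induced_map fst z \<noteq> induced_map snd z"
  proof
    \<comment> \<open>If a first entry \<open>v\<close> of a vertex \<open>(v, u)\<close> of the carrier were also a second entry, then
      injectivity of \<open>f\<close> on the simplex of second entries would give \<open>v = u\<close>.\<close>
    assume "induced_map fst z = induced_map snd z"
    then have "fst ` ?S = snd ` ?S"
      using support_induced_map[of z] z'(1) by metis
    moreover obtain v u where vu: "(v, u) \<in> ?S"
      using S(4) by auto
    ultimately have "v \<in> snd ` ?S" "u \<in> snd ` ?S"
      by force+
    moreover have "inj_on f (snd ` ?S)"
      using nondegenerate S(2) by (simp add: nondegenerate_def)
    moreover have "f v = f u" "v \<noteq> u"
      using vu S(3) by (auto simp: double_vertices_def)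
    ultimately show False
      by (auto dest: inj_onD)
  qed
  ultimately show ?thesis
    using in_K by (simp add: double_point_def)
qed

end

section \<open>The double covering\<close>

lemma sign_constant:
  fixes d :: "'a::topological_space \<Rightarrow> real"
  assumes S: "connected S" and d: "continuous_on S d" and nz: "\<And>z. z \<in> S \<Longrightarrow> d z \<noteq> 0"
    and xy: "x \<in> S" "y \<in> S"
  shows "d x > 0 \<longleftrightarrow> d y > 0"
proof -
  have *: "\<not> (d u > 0 \<and> d v < 0)" if "u \<in> S" "v \<in> S" for u v
  proof
    assume "d u > 0 \<and> d v < 0"
    then have "0 \<in> d ` S"
      using that connectedD_interval[OF connected_continuous_image[OF d S], of "d v" "d u" 0]
      by (simp add: order_less_imp_le)
    then show False
      using nz by auto
  qed
  show ?thesis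
    using *[OF xy] *[OF xy(2,1)] nz[OF xy(1)] nz[OF xy(2)] by linarith
qed

lemma continuous_on_induced_map: "continuous_on S (induced_map f)"
  using linear_induced_map linear_continuous_on linear_conv_bounded_linear by blast

lemma tau_vertex_point: "tau (vertex_point (a, b)) = vertex_point (b, a)"
  by (simp add: tau_def induced_map_vertex_point)

lemma induced_map_fst_tau: "induced_map fst (tau z) = induced_map snd z"
  by (simp add: tau_def induced_map_comp comp_def prod.swap_def)

lemma induced_map_snd_tau: "induced_map snd (tau z) = induced_map fst z"
  by (simp add: tau_def induced_map_comp comp_def prod.swap_def)

lemma continuous_on_tau: "continuous_on S tau"
  unfolding tau_def by (rule continuous_on_induced_map)

lemma tau_image_image: "tau ` tau ` S = S"
  by (simp add: image_image tau_tau)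

lemma p2_eq_iff: "p2 x = p2 y \<longleftrightarrow> x = y \<or> x = tau y"
  using tau_tau[of x] tau_tau[of y] unfolding p2_def by (metis doubleton_eq_iff)

text \<open>The defining condition of the quotient topology concerns subsets of the image of \<open>q\<close>, which is
  itself open; hence it is the whole space.\<close>

lemma topspace_quotient_topology: "topspace (quotient_topology X q) = q ` topspace X"
proof
  show "topspace (quotient_topology X q) \<subseteq> q ` topspace X"
    using openin_topspace[of "quotient_topology X q"] unfolding openin_quotient_topology by blast
  have "{x \<in> topspace X. q x \<in> q ` topspace X} = topspace X"
    by blast
  then have "openin (quotient_topology X q) (q ` topspace X)"
    unfolding openin_quotient_topology by simp
  then show "q ` topspace X \<subseteq> topspace (quotient_topology X q)"
    by (rule openin_subset)
qed

lemma continuous_map_quotient_topology: "continuous_map X (quotient_topology X q) q"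
  unfolding continuous_map_def topspace_quotient_topology openin_quotient_topology by blast

context nondegenerate_simplicial_map
begin

lemma tau_in_double_space:
  assumes "z \<in> double_space"
  shows "tau z \<in> double_space"
  unfolding tau_def
proof (rule induced_map_in_realisation[OF complex_double complex_double _ assms])
  fix S assume S: "S \<in> double_complex K f"
  have "fst ` prod.swap ` S = snd ` S" "snd ` prod.swap ` S = fst ` S"
    by (simp_all add: image_image)
  moreover have "card (prod.swap ` S) = card S"
    by (simp add: card_image)
  moreover have "prod.swap ` S \<subseteq> double_vertices K f"
    using S by (auto simp: double_complex_def double_vertices_def)
  ultimately show "prod.swap ` S \<in> double_complex K f"
    using S by (simp add: double_complex_def)
qed

lemma tau_image_double_component:
  assumes C: "C \<in> double_components K f"
  shows "tau ` C \<in> double_components K f"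
proof -
  have C': "C \<noteq> {}" "C \<subseteq> double_space" "connected C"
      "\<And>D. D \<noteq> {} \<Longrightarrow> C \<subseteq> D \<Longrightarrow> D \<subseteq> double_space \<Longrightarrow> connected D \<Longrightarrow> D = C"
    using C unfolding double_components_def in_components_maximal by blast+
  have "D = tau ` C" if D: "D \<noteq> {}" "tau ` C \<subseteq> D" "D \<subseteq> double_space" "connected D" for D
  proof -
    have "C \<subseteq> tau ` D"
      using image_mono[OF D(2), of tau] by (simp only: tau_image_image)
    moreover have "tau ` D \<subseteq> double_space"
      using D(3) tau_in_double_space by blast
    moreover have "connected (tau ` D)"
      by (rule connected_continuous_image[OF continuous_on_tau D(4)])
    ultimately have "tau ` D = C"
      using D(1) by (intro C'(4)) simp_all
    then show ?thesis
      using tau_image_image[of D] by simp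
  qed
  moreover have "tau ` C \<subseteq> double_space"
    using C'(2) tau_in_double_space by blast
  moreover have "connected (tau ` C)"
    by (rule connected_continuous_image[OF continuous_on_tau C'(3)])
  ultimately show ?thesis
    using C'(1) unfolding double_components_def in_components_maximal by blast
qed

lemma double_component_unique:
  "\<lbrakk>C \<in> double_components K f; D \<in> double_components K f; z \<in> C; z \<in> D\<rbrakk> \<Longrightarrow> C = D"
  unfolding double_components_def using components_nonoverlap by blast

lemma double_component_exists:
  assumes "p \<in> double_vertices K f"
  obtains C where "C \<in> double_components K f" "vertex_point p \<in> C"
proof -
  have "vertex_point p \<in> \<Union>(double_components K f)"
    using assms by (simp add: double_components_def vertex_point_in_double_space)
  then show ?thesis
    using that by blast
qed

lemma simplex_in_double_component:
  assumes S: "S \<in> double_complex K f" and p: "p \<in> S" and C: "C \<in> double_components K f"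
    and pC: "vertex_point p \<in> C"
  shows "convex hull (vertex_point ` S) \<subseteq> C"
proof (rule components_maximal)
  show "C \<in> components double_space"
    using C by (simp add: double_components_def)
  show "connected (convex hull (vertex_point ` S))"
    by (rule convex_connected[OF convex_convex_hull])
  show "convex hull (vertex_point ` S) \<subseteq> double_space"
    using S unfolding realisation_def by blast
  show "C \<inter> convex hull (vertex_point ` S) \<noteq> {}"
    using pC p hull_inc[of "vertex_point p" "vertex_point ` S" convex] by blast
qed

text \<open>Components contain whole simplices, so each of them is represented by a vertex pair.\<close>

lemma double_component_vertex:
  assumes C: "C \<in> double_components K f"
  obtains p where "p \<in> double_vertices K f" "vertex_point p \<in> C"
proof -
  have sub: "C \<subseteq> double_space" and "C \<noteq> {}"
    using C unfolding double_components_def in_components_maximal by blast+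
  then obtain z S where z: "z \<in> C" "S \<in> double_complex K f" "z \<in> convex hull (vertex_point ` S)"
    unfolding realisation_def by blast
  then obtain p where p: "p \<in> S"
    by (auto simp: double_complex_def)
  then have "p \<in> double_vertices K f"
    using z(2) by (auto simp: double_complex_def)
  then obtain D where D: "D \<in> double_components K f" "vertex_point p \<in> D"
    by (rule double_component_exists)
  then have "z \<in> D"
    using simplex_in_double_component[OF z(2) p D] z(3) by blast
  then have "C = D"
    by (rule double_component_unique[OF C D(1) z(1)])
  then show ?thesis
    using that D \<open>p \<in> double_vertices K f\<close> by blast
qed

text \<open>A trivialisation assigns one of two sheets to each point, continuously, and \<open>tau\<close> exchanges the sheets.
  The sheet is constant on a connected set, so \<open>tau\<close> cannot map a component to itself.\<close>

lemma tau_double_component_neq: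
  assumes triv: "p2_trivial K f" and C: "C \<in> double_components K f"
  shows "tau ` C \<noteq> C"
proof
  assume eq: "tau ` C = C"
  obtain h where h: "homeomorphic_map (top_of_set double_space)
        (prod_topology (double_quotient K f) (discrete_topology (UNIV :: bool set))) h"
      "\<And>x. x \<in> double_space \<Longrightarrow> h (tau x) = (p2 x, \<not> snd (h x))"
    using triv unfolding p2_trivial_def by blast
  define sheet :: "real ^ ('v \<times> 'v) \<Rightarrow> real" where "sheet = (\<lambda>b. if b then 1 else - 1) \<circ> (snd \<circ> h)"
  have C': "C \<noteq> {}" "C \<subseteq> double_space" "connected C"
    using C unfolding double_components_def in_components_maximal by blast+
  have "continuous_map (top_of_set double_space) euclideanreal sheet"
    unfolding sheet_def
    by (rule continuous_map_compose[OF continuous_map_snd_of[OF homeomorphic_imp_continuous_map[OF h(1)]]])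
      simp
  then have "continuous_on C sheet"
    using C'(2) by (simp add: continuous_on_subset)
  moreover obtain x where x: "x \<in> C"
    using C'(1) by blast
  moreover have "tau x \<in> C"
    using x eq by blast
  ultimately have "sheet x > 0 \<longleftrightarrow> sheet (tau x) > 0"
    using C'(3) by (intro sign_constant) (auto simp: sheet_def)
  moreover have "x \<in> double_space"
    using C'(2) x by blast
  ultimately show False
    using h(2) by (simp add: sheet_def split: if_splits)
qed

text \<open>The saturation of an open set \<open>U\<close> is the union of \<open>U\<close> and its image under the homeomorphism \<open>tau\<close>.\<close>

lemma open_map_p2:
  "open_map (top_of_set double_space) (double_quotient K f) p2"
  unfolding open_map_def
proof (intro allI impI)
  fix U assume U: "openin (top_of_set double_space) U"
  then have sub: "U \<subseteq> double_space"
    by (rule openin_imp_subset)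
  have "{z \<in> double_space. p2 z \<in> p2 ` U} = U \<union> {z \<in> double_space. tau z \<in> U}"
  proof (intro set_eqI iffI)
    fix z assume "z \<in> {z \<in> double_space. p2 z \<in> p2 ` U}"
    then obtain u where "z \<in> double_space" "u \<in> U" "z = u \<or> z = tau u"
      by (auto simp: p2_eq_iff)
    then show "z \<in> U \<union> {z \<in> double_space. tau z \<in> U}"
      by (auto simp: tau_tau)
  next
    fix z assume z: "z \<in> U \<union> {z \<in> double_space. tau z \<in> U}"
    then have "p2 z \<in> p2 ` U"
    proof
      assume "z \<in> {z \<in> double_space. tau z \<in> U}"
      then have "p2 (tau z) \<in> p2 ` U" "p2 z = p2 (tau z)"
        by (auto simp: p2_eq_iff tau_tau)
      then show ?thesis
        by simp
    qed simp
    with z sub show "z \<in> {z \<in> double_space. p2 z \<in> p2 ` U}"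
      by blast
  qed
  moreover have "openin (top_of_set double_space) {z \<in> double_space. tau z \<in> U}"
    using openin_continuous_map_preimage[of "top_of_set double_space" "top_of_set double_space" tau U]
      U tau_in_double_space by (simp add: continuous_on_tau image_subset_iff_funcset[symmetric] image_subset_iff)
  ultimately have "openin (top_of_set double_space) {z \<in> double_space. p2 z \<in> p2 ` U}"
    using U by (simp add: openin_Un)
  then show "openin (double_quotient K f) (p2 ` U)"
    using sub by (simp add: double_quotient_def openin_quotient_topology image_mono)
qed

text \<open>The sets where \<open>d\<close> is positive and where it is negative are open, and \<open>tau\<close> exchanges them. Each
  is a sheet of the covering, and the sign of \<open>d\<close> is the second coordinate of the trivialisation.\<close>

lemma p2_trivialI:
  fixes d :: "real ^ ('v \<times> 'v) \<Rightarrow> real"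
  assumes d: "continuous_on double_space d" and nz: "\<And>z. z \<in> double_space \<Longrightarrow> d z \<noteq> 0"
    and odd: "\<And>z. z \<in> double_space \<Longrightarrow> d (tau z) = - d z"
  shows "p2_trivial K f"
  unfolding p2_trivial_def
proof (intro exI conjI ballI)
  let ?X = "top_of_set double_space"
  let ?B = "discrete_topology (UNIV :: bool set)"
  define h where "h z = (p2 z, d z > 0)" for z
  have pos: "openin ?X {z \<in> double_space. d z > 0}" and neg: "openin ?X {z \<in> double_space. d z < 0}"
    using openin_continuous_map_preimage[of ?X euclideanreal d "{0<..}"]
      openin_continuous_map_preimage[of ?X euclideanreal d "{..<0}"] d by simp_all
  have sign: "d z < 0 \<longleftrightarrow> \<not> d z > 0" if "z \<in> double_space" for z
    using nz[OF that] by linarith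
  show "homeomorphic_map ?X (prod_topology (double_quotient K f) ?B) h"
  proof (rule bijective_open_imp_homeomorphic_map)
    have "openin ?X {z \<in> double_space. (d z > 0) \<in> U}" for U :: "bool set"
    proof -
      have "{z \<in> double_space. (d z > 0) \<in> U} =
          (if True \<in> U then {z \<in> double_space. d z > 0} else {}) \<union>
          (if False \<in> U then {z \<in> double_space. d z < 0} else {})"
        using sign by auto (metis (full_types))+
      then show ?thesis
        using pos neg by (simp add: openin_Un)
    qed
    then have "continuous_map ?X ?B (\<lambda>z. d z > 0)"
      by (simp add: continuous_map_def)
    then show "continuous_map ?X (prod_topology (double_quotient K f) ?B) h"
      unfolding h_def double_quotient_def
      by (intro continuous_map_pairedI continuous_map_quotient_topology)
    show "open_map ?X (prod_topology (double_quotient K f) ?B) h"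
      unfolding open_map_def
    proof (intro allI impI)
      fix U assume U: "openin ?X U"
      let ?P = "U \<inter> {z \<in> double_space. d z > 0}" and ?N = "U \<inter> {z \<in> double_space. d z < 0}"
      have "U \<subseteq> double_space"
        using U by (rule openin_imp_subset)
      then have U_eq: "U = ?P \<union> ?N"
        using sign by auto
      have "h ` ?P = p2 ` ?P \<times> {True}"
        by (auto simp: h_def)
      moreover have "h ` ?N = p2 ` ?N \<times> {False}"
        by (auto simp: h_def)
      ultimately have "h ` U = (p2 ` ?P \<times> {True}) \<union> (p2 ` ?N \<times> {False})"
        by (subst U_eq) (simp only: image_Un)
      moreover have "openin (double_quotient K f) (p2 ` ?P)" "openin (double_quotient K f) (p2 ` ?N)"
        using open_map_p2 U pos neg unfolding open_map_def by (simp_all add: openin_Int)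
      ultimately show "openin (prod_topology (double_quotient K f) ?B) (h ` U)"
        by (simp add: openin_Un openin_prod_Times_iff)
    qed
    show "h ` topspace ?X = topspace (prod_topology (double_quotient K f) ?B)"
    proof
      show "h ` topspace ?X \<subseteq> topspace (prod_topology (double_quotient K f) ?B)"
        by (auto simp: h_def double_quotient_def topspace_quotient_topology)
      show "topspace (prod_topology (double_quotient K f) ?B) \<subseteq> h ` topspace ?X"
      proof
        fix w assume "w \<in> topspace (prod_topology (double_quotient K f) ?B)"
        then obtain z b where z: "z \<in> double_space" "w = (p2 z, b)"
          by (auto simp: double_quotient_def topspace_quotient_topology)
        have "p2 (tau z) = p2 z"
          by (simp add: p2_eq_iff)
        then have "w = h z \<or> w = h (tau z)"
          using sign[OF z(1)] odd[OF z(1)] z(2) by (auto simp: h_def)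
        then show "w \<in> h ` topspace ?X"
          using z(1) tau_in_double_space[OF z(1)] by auto
      qed
    qed
    show "inj_on h (topspace ?X)"
    proof (rule inj_onI)
      fix x y assume xy: "x \<in> topspace ?X" "y \<in> topspace ?X" "h x = h y"
      then have "x = y \<or> x = tau y" "d x > 0 \<longleftrightarrow> d y > 0"
        by (simp_all add: h_def p2_eq_iff)
      then show "x = y"
        using odd[of y] nz[of y] xy(2) by auto
    qed
  qed
  fix z assume z: "z \<in> double_space"
  show "fst (h z) = p2 z"
    by (simp add: h_def)
  have "p2 (tau z) = p2 z"
    by (simp add: p2_eq_iff)
  then show "h (tau z) = (p2 z, \<not> snd (h z))"
    using odd[OF z] sign[OF z] by (simp add: h_def)
qed

end

section \<open>Liftings as height functions\<close>

context nondegenerate_simplicial_map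
begin

text \<open>The height functions that occur in liftings, except for piecewise linearity.\<close>

definition separating :: "(real ^ 'v \<Rightarrow> real) \<Rightarrow> bool" where
  "separating k \<longleftrightarrow> continuous_on (realisation K) k \<and> (\<forall>x y. double_point x y \<longrightarrow> k x \<noteq> k y)"

text \<open>The strict orders which \<open>k\<close> induces on the vertices in each fibre of \<open>f\<close>.\<close>

definition below :: "(real ^ 'v \<Rightarrow> real) \<Rightarrow> ('v \<times> 'v) set" where
  "below k = {(v, u) \<in> double_vertices K f. k (vertex_point v) < k (vertex_point u)}"

lemma separating_continuous: "separating k \<Longrightarrow> continuous_on (realisation K) k"
  by (simp add: separating_def)

lemma separating_neq: "separating k \<Longrightarrow> double_point x y \<Longrightarrow> k x \<noteq> k y"
  by (simp add: separating_def)

text \<open>While a double point is contracted to a pair of vertices, the height difference never vanishes.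
  So the order of the vertices in the fibres determines the order at all double points.\<close>

lemma separating_sign:
  assumes k: "separating k" and xy: "double_point x y" and p: "(v, u) \<in> moved x y"
  shows "k x < k y \<longleftrightarrow> (v, u) \<in> below k"
proof -
  define a where "a s = (1 - s) *\<^sub>R x + s *\<^sub>R vertex_point v" for s :: real
  define b where "b s = (1 - s) *\<^sub>R y + s *\<^sub>R vertex_point u" for s :: real
  have ab: "double_point (a s) (b s)" if "s \<in> {0..1}" for s
    unfolding a_def b_def using double_point_segment[OF xy p] that by simp
  have "continuous_on {0..1} a" "continuous_on {0..1} b"
    unfolding a_def b_def by (intro continuous_intros)+
  moreover have "a ` {0..1} \<subseteq> realisation K" "b ` {0..1} \<subseteq> realisation K"
    using ab unfolding double_point_def by blast+
  ultimately have "continuous_on {0..1} (\<lambda>s. k (b s) - k (a s))"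
    by (intro continuous_on_diff continuous_on_compose2[OF separating_continuous[OF k]])
  moreover have "k (b s) - k (a s) \<noteq> 0" if "s \<in> {0..1}" for s
    using separating_neq[OF k ab[OF that]] by simp
  ultimately have "k (b 0) - k (a 0) > 0 \<longleftrightarrow> k (b 1) - k (a 1) > 0"
    by (intro sign_constant[of "{0..1}"]) auto
  moreover have "(v, u) \<in> double_vertices K f"
    using moved_in_double_complex[OF xy] p by (auto simp: double_complex_def)
  ultimately show ?thesis
    by (simp add: a_def b_def below_def)
qed

lemma below_swap:
  assumes "separating k" "(v, u) \<in> double_vertices K f"
  shows "(u, v) \<in> below k \<longleftrightarrow> (v, u) \<notin> below k"
proof -
  have "k (vertex_point v) \<noteq> k (vertex_point u)"
    using separating_neq[OF assms(1)] double_point_vertex_points[OF assms(2)] by blast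
  then show ?thesis
    using assms(2) by (auto simp: below_def double_vertices_def)
qed

text \<open>The height difference as a function on the double space. It is odd under \<open>tau\<close>, and for
  separating \<open>k\<close> its sign is both a trivialisation of the covering and an assignment of truth values to the components.\<close>

definition gap :: "(real ^ 'v \<Rightarrow> real) \<Rightarrow> real ^ ('v \<times> 'v) \<Rightarrow> real" where
  "gap k z = k (induced_map snd z) - k (induced_map fst z)"

lemma gap_nonzero: "separating k \<Longrightarrow> z \<in> double_space \<Longrightarrow> gap k z \<noteq> 0"
  using double_point_projections[of z] separating_neq unfolding gap_def by fastforce

lemma continuous_on_gap:
  assumes "separating k"
  shows "continuous_on double_space (gap k)"
  unfolding gap_def
  by (intro continuous_on_diff continuous_on_compose2[OF separating_continuous[OF assms]]
      continuous_on_induced_map)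
    (use double_point_projections in \<open>unfold double_point_def, blast+\<close>)

lemma p2_trivial_if_separating:
  assumes "separating k"
  shows "p2_trivial K f"
  by (rule p2_trivialI[OF continuous_on_gap[OF assms] gap_nonzero[OF assms]])
    (simp_all add: gap_def induced_map_fst_tau induced_map_snd_tau)

lemma below_constant_on_component:
  assumes k: "separating k" and C: "C \<in> double_components K f"
    and p: "vertex_point p \<in> C" and q: "vertex_point q \<in> C"
  shows "p \<in> below k \<longleftrightarrow> q \<in> below k"
proof -
  have sub: "C \<subseteq> double_space" and "connected C"
    using C unfolding double_components_def in_components_maximal by blast+
  have "gap k (vertex_point p) > 0 \<longleftrightarrow> gap k (vertex_point q) > 0"
    using \<open>connected C\<close> continuous_on_subset[OF continuous_on_gap[OF k] sub] _ p q
    by (rule sign_constant) (use gap_nonzero[OF k] sub in blast)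
  moreover have "gap k (vertex_point r) > 0 \<longleftrightarrow> r \<in> below k" if "vertex_point r \<in> C" for r
  proof -
    have "r \<in> double_vertices K f"
      using that sub vertex_point_in_double_space by blast
    then show ?thesis
      by (auto simp: gap_def below_def induced_map_vertex_point)
  qed
  ultimately show ?thesis
    using p q by blast
qed

definition linear_height :: "('v \<Rightarrow> real) \<Rightarrow> real ^ 'v \<Rightarrow> real" where
  "linear_height c x = (\<Sum>v\<in>UNIV. x $ v * c v)"

lemma linear_linear_height: "linear (linear_height c)"
  unfolding linear_height_def
  by (rule linearI) (simp_all add: sum.distrib distrib_right sum_distrib_left mult.assoc)

lemma linear_height_vertex_point: "linear_height c (vertex_point v) = c v"
  by (simp add: linear_height_def vertex_point_nth if_distrib[of "\<lambda>t. t * _"] cong: if_cong)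

text \<open>The height difference at a double point is a combination with positive coefficients of the differences
  over the pairs in one simplex of the double complex, which all have the same sign.\<close>

lemma separating_linear_height:
  assumes c: "\<And>S. S \<in> double_complex K f \<Longrightarrow>
    (\<forall>(v, u)\<in>S. c v < c u) \<or> (\<forall>(v, u)\<in>S. c u < c v)"
  shows "separating (linear_height c)"
  unfolding separating_def
proof (intro conjI allI impI)
  show "continuous_on (realisation K) (linear_height c)"
    using linear_linear_height linear_continuous_on linear_conv_bounded_linear by blast
  fix x y assume xy: "double_point x y"
  let ?t = "\<lambda>p. x $ fst p * (c (snd p) - c (fst p))"
  have pos: "x $ fst p > 0" if "p \<in> moved x y" for p
  proof -
    have "fst p \<in> support x"
      using that by (auto simp: moved_def matching_def)
    then show ?thesis
      using xy by (simp add: double_point_def mem_realisation[OF complex_K] support_def order_less_le)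
  qed
  have "(\<Sum>p\<in>moved x y. ?t p) \<noteq> 0"
    using c[OF moved_in_double_complex[OF xy]]
  proof
    assume "\<forall>(v, u)\<in>moved x y. c v < c u"
    then have "\<forall>p\<in>moved x y. 0 < ?t p"
      using pos by force
    then have "0 < (\<Sum>p\<in>moved x y. ?t p)"
      using moved_nonempty[OF xy] by (intro sum_pos) auto
    then show ?thesis
      by simp
  next
    assume "\<forall>(v, u)\<in>moved x y. c u < c v"
    then have "\<forall>p\<in>moved x y. 0 < - ?t p"
      using pos by (force simp: mult_less_0_iff)
    then have "0 < (\<Sum>p\<in>moved x y. - ?t p)"
      using moved_nonempty[OF xy] by (intro sum_pos) auto
    then show ?thesis
      by (simp add: sum_negf)
  qed
  then show "linear_height c x \<noteq> linear_height c y"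
    using height_difference[OF xy, of c] by (auto simp: linear_height_def)
qed

abbreviation is_lifting :: "(real ^ 'v \<Rightarrow> (real ^ 'w) \<times> real) \<Rightarrow> bool" where
  "is_lifting \<equiv> lifting (realisation K) (realisation L) (induced_map f)"

abbreviation isotopic ::
    "(real ^ 'v \<Rightarrow> (real ^ 'w) \<times> real) \<Rightarrow> (real ^ 'v \<Rightarrow> (real ^ 'w) \<times> real) \<Rightarrow> bool" where
  "isotopic \<equiv> isotopic_liftings (realisation K) (realisation L) (induced_map f)"

lemma lifting_continuous:
  assumes "is_lifting g"
  shows "continuous_on (realisation K) g"
proof -
  have "continuous_map (top_of_set (realisation K)) (top_of_set (realisation L \<times> (UNIV :: real set))) g"
    using assms unfolding lifting_def embedding_map_def
    by (blast dest: homeomorphic_imp_continuous_map continuous_map_into_fulltopology)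
  then show ?thesis
    by simp
qed

lemma lifting_separating:
  assumes g: "is_lifting g"
  shows "separating (snd \<circ> g)"
  unfolding separating_def
proof (intro conjI allI impI)
  show "continuous_on (realisation K) (snd \<circ> g)"
    using lifting_continuous[OF g] by (simp add: comp_def continuous_on_snd)
  fix x y assume xy: "double_point x y"
  have "inj_on g (realisation K)"
    using g homeomorphic_imp_injective_map unfolding lifting_def embedding_map_def by fastforce
  then have "g x \<noteq> g y"
    using xy by (auto simp: double_point_def dest: inj_onD)
  moreover have "fst (g x) = fst (g y)"
    using g xy by (auto simp: lifting_def double_point_def)
  ultimately show "(snd \<circ> g) x \<noteq> (snd \<circ> g) y"
    by (simp add: prod_eq_iff)
qed

text \<open>A lifting is injective precisely because its height separates double points; a continuous injection of a
  compact space into a Hausdorff space is an embedding.\<close>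

lemma liftingI:
  assumes pl: "piecewise_linear_on (realisation K) g" and cont: "continuous_on (realisation K) g"
    and fst_g: "\<And>x. x \<in> realisation K \<Longrightarrow> fst (g x) = induced_map f x"
    and sep: "separating (snd \<circ> g)"
  shows "is_lifting g"
proof -
  let ?X = "top_of_set (realisation K)"
  let ?Y = "top_of_set (realisation L \<times> (UNIV :: real set))"
  have img: "g ` realisation K \<subseteq> realisation L \<times> UNIV"
  proof (rule image_subsetI)
    fix x assume x: "x \<in> realisation K"
    have "induced_map f x \<in> realisation L"
      by (rule induced_map_in_realisation[OF complex_K complex_L image_in_L x])
    then show "g x \<in> realisation L \<times> UNIV"
      using fst_g[OF x] by (simp add: mem_Times_iff)
  qed
  have inj: "inj_on g (realisation K)"
  proof (rule inj_onI, rule ccontr)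
    fix x y assume xy: "x \<in> realisation K" "y \<in> realisation K" "g x = g y" "x \<noteq> y"
    then have "double_point x y"
      using fst_g by (metis double_point_def)
    then show False
      using separating_neq[OF sep] xy(3) by fastforce
  qed
  have "continuous_map ?X ?Y g"
    using cont img by (simp add: image_subset_iff_funcset)
  moreover have "compact_space ?X"
    using compact_realisation[OF complex_K] by (simp add: compact_space_subtopology)
  moreover have "Hausdorff_space ?Y"
    by (simp add: Hausdorff_space_subtopology)
  ultimately have "closed_map ?X ?Y g"
    by (intro continuous_imp_closed_map_gen Hausdorff_imp_kc_space)
  then have "embedding_map ?X ?Y g"
    using \<open>continuous_map ?X ?Y g\<close> inj by (intro injective_closed_imp_embedding_map) simp_all
  then show ?thesis
    using pl img fst_g by (simp add: lifting_def)
qed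

definition linear_lift :: "('v \<Rightarrow> real) \<Rightarrow> real ^ 'v \<Rightarrow> (real ^ 'w) \<times> real" where
  "linear_lift c x = (induced_map f x, linear_height c x)"

lemma linear_linear_lift: "linear (linear_lift c)"
  unfolding linear_lift_def
  by (rule linearI) (simp_all add: linear_add[OF linear_induced_map] linear_scale[OF linear_induced_map]
      linear_add[OF linear_linear_height] linear_scale[OF linear_linear_height])

lemma snd_linear_lift: "snd \<circ> linear_lift c = linear_height c"
  by (simp add: fun_eq_iff linear_lift_def)

lemma continuous_on_linear_lift: "continuous_on S (linear_lift c)"
  using linear_linear_lift linear_continuous_on linear_conv_bounded_linear by blast

lemma is_lifting_linear_lift:
  assumes "separating (linear_height c)"
  shows "is_lifting (linear_lift c)"
proof (rule liftingI)
  show "piecewise_linear_on (realisation K) (linear_lift c)"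
    unfolding piecewise_linear_on_def
  proof (intro exI conjI ballI)
    show "triangulation ((\<lambda>\<sigma>. convex hull (vertex_point ` \<sigma>)) ` K)"
      by (rule triangulation_realisation[OF complex_K])
    show "\<Union>((\<lambda>\<sigma>. convex hull (vertex_point ` \<sigma>)) ` K) = realisation K"
      by (simp add: realisation_def)
    fix S :: "(real ^ 'v) set"
    show "linear (linear_lift c)"
      by (rule linear_linear_lift)
    show "linear_lift c x = linear_lift c x + 0" for x
      by simp
  qed
qed (simp_all add: snd_linear_lift assms continuous_on_linear_lift, simp add: linear_lift_def)

lemma isotopic_refl:
  assumes "is_lifting g"
  shows "isotopic g g"
  using assms lifting_continuous[OF assms] unfolding isotopic_liftings_def
  by (simp add: lifting_def image_subset_iff_funcset)

lemma isotopic_sym: "isotopic g h \<Longrightarrow> isotopic h g"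
  unfolding isotopic_liftings_def by (rule homotopic_with_symD)

lemma isotopic_trans: "isotopic g h \<Longrightarrow> isotopic h k \<Longrightarrow> isotopic g k"
  unfolding isotopic_liftings_def by (rule homotopic_with_trans)

text \<open>For a pair of vertices, the height difference is a function of time without zeros.\<close>

lemma isotopic_below:
  assumes "isotopic g h"
  shows "below (snd \<circ> g) = below (snd \<circ> h)"
proof -
  obtain F where F: "continuous_map (prod_topology (top_of_set {0..1::real}) (top_of_set (realisation K)))
        (top_of_set (realisation L \<times> (UNIV :: real set))) F"
      "\<And>x. F (0, x) = g x" "\<And>x. F (1, x) = h x"
      "\<And>t. t \<in> {0..1} \<Longrightarrow> is_lifting (\<lambda>x. F (t, x))"
    using assms unfolding isotopic_liftings_def homotopic_with_def by blast
  have cont: "continuous_on ({0..1} \<times> realisation K) F"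
    using F(1) by simp
  have "(v, u) \<in> below (snd \<circ> g) \<longleftrightarrow> (v, u) \<in> below (snd \<circ> h)" if vu: "(v, u) \<in> double_vertices K f" for v u
  proof -
    let ?d = "\<lambda>t. snd (F (t, vertex_point u)) - snd (F (t, vertex_point v))"
    have vp: "vertex_point v \<in> realisation K" "vertex_point u \<in> realisation K"
      using double_point_vertex_points[OF vu] by (simp_all add: double_point_def)
    have "continuous_on {0..1} ?d"
      using vp by (intro continuous_intros continuous_on_compose2[OF cont]) auto
    moreover have "?d t \<noteq> 0" if "t \<in> {0..1}" for t
      using separating_neq[OF lifting_separating[OF F(4)[OF that]] double_point_vertex_points[OF vu]]
      by simp
    ultimately have "?d 0 > 0 \<longleftrightarrow> ?d 1 > 0"
      by (intro sign_constant[of "{0..1}"]) auto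
    then show ?thesis
      using vu by (simp add: below_def F(2,3))
  qed
  then show ?thesis
    by (auto simp: below_def)
qed

text \<open>The straight-line homotopy is an isotopy: at each double point both height differences have the sign
  given by the common order of the vertices, and so has every convex combination of them.\<close>

lemma isotopic_linear_lift:
  assumes g: "is_lifting g" and c: "separating (linear_height c)"
    and same: "below (snd \<circ> g) = below (linear_height c)"
  shows "isotopic g (linear_lift c)"
proof -
  define F where "F t x = (1 - t) *\<^sub>R g x + t *\<^sub>R linear_lift c x" for t :: real and x
  have fst_F: "fst (F t x) = induced_map f x" if "x \<in> realisation K" for t x
    using g that by (simp add: F_def lifting_def linear_lift_def algebra_simps)
  have cont: "continuous_on ({0..1} \<times> realisation K) (\<lambda>(t, x). F t x)"
    unfolding F_def case_prod_unfold
    by (intro continuous_intros continuous_on_compose2[OF lifting_continuous[OF g]]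
        continuous_on_compose2[OF continuous_on_linear_lift[of UNIV]]) auto
  have "is_lifting (F t)" if t: "t \<in> {0..1}" for t
  proof (rule liftingI)
    \<comment> \<open>The second map is linear on the whole space, so a triangulation adapted to \<open>g\<close> serves the
      whole isotopy and no common subdivision is called for.\<close>
    show "piecewise_linear_on (realisation K) (F t)"
    proof -
      have "piecewise_linear_on (realisation K) g"
        using g by (simp add: lifting_def)
      then obtain \<T> where T: "triangulation \<T>" "\<Union>\<T> = realisation K"
          "\<forall>S\<in>\<T>. \<exists>a b. linear a \<and> (\<forall>x\<in>S. g x = a x + b)"
        unfolding piecewise_linear_on_def by (elim exE conjE)
      have "\<exists>a b. linear a \<and> (\<forall>x\<in>S. F t x = a x + b)" if S: "S \<in> \<T>" for S
      proof -
        obtain a b where ab: "linear a" "\<forall>x\<in>S. g x = a x + b"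
          using bspec[OF T(3) S] by (elim exE conjE)
        have "linear (\<lambda>x. (1 - t) *\<^sub>R a x + t *\<^sub>R linear_lift c x)"
          by (intro linear_compose_add linear_compose_scale_right ab(1) linear_linear_lift)
        moreover have "\<forall>x\<in>S. F t x = ((1 - t) *\<^sub>R a x + t *\<^sub>R linear_lift c x) + (1 - t) *\<^sub>R b"
          using ab(2) by (simp add: F_def scaleR_add_right)
        ultimately show ?thesis
          by (intro exI conjI)
      qed
      then show ?thesis
        unfolding piecewise_linear_on_def by (intro exI[of _ \<T>] conjI ballI T(1,2))
    qed
    show contF: "continuous_on (realisation K) (F t)"
      unfolding F_def[abs_def]
      by (intro continuous_intros lifting_continuous[OF g] continuous_on_linear_lift)
    show "separating (snd \<circ> F t)"
      unfolding separating_def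
    proof (intro conjI allI impI)
      show "continuous_on (realisation K) (snd \<circ> F t)"
        using contF by (simp add: comp_def continuous_on_snd)
      fix x y assume xy: "double_point x y"
      obtain v u where vu: "(v, u) \<in> moved x y"
        using moved_nonempty[OF xy] by auto
      let ?g = "(snd \<circ> g) y - (snd \<circ> g) x" and ?l = "linear_height c y - linear_height c x"
      have nz: "?g \<noteq> 0" "?l \<noteq> 0"
        using separating_neq[OF lifting_separating[OF g] xy] separating_neq[OF c xy] by simp_all
      have "?g > 0 \<longleftrightarrow> ?l > 0"
        using separating_sign[OF lifting_separating[OF g] xy vu] separating_sign[OF c xy vu] same
        by simp
      then have "?g > 0 \<and> ?l > 0 \<or> ?g < 0 \<and> ?l < 0"
        using nz by linarith
      then have "(1 - t) * ?g + t * ?l \<noteq> 0"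
      proof
        assume "?g > 0 \<and> ?l > 0"
        then have "(1 - t) * (- ?g) + t * (- ?l) < 0"
          using t by (intro convex_bound_lt) auto
        then show ?thesis
          unfolding mult_minus_right by linarith
      next
        assume "?g < 0 \<and> ?l < 0"
        then have "(1 - t) * ?g + t * ?l < 0"
          using t by (intro convex_bound_lt) auto
        then show ?thesis
          by linarith
      qed
      moreover have "(snd \<circ> F t) y - (snd \<circ> F t) x = (1 - t) * ?g + t * ?l"
        by (simp add: F_def linear_lift_def algebra_simps)
      ultimately show "(snd \<circ> F t) x \<noteq> (snd \<circ> F t) y"
        by auto
    qed
  qed (use fst_F in blast)
  then have lift: "\<And>t. t \<in> {0..1} \<Longrightarrow> is_lifting (F t)" .
  let ?F = "\<lambda>(t, x). F t x"
  have "?F \<in> {0..1} \<times> realisation K \<rightarrow> realisation L \<times> UNIV"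
    using lift unfolding lifting_def by fastforce
  then have "continuous_map (prod_topology (top_of_set {0..1}) (top_of_set (realisation K)))
      (top_of_set (realisation L \<times> UNIV)) ?F"
    using cont by simp
  moreover have "\<forall>x. ?F (0, x) = g x" "\<forall>x. ?F (1, x) = linear_lift c x"
    by (simp_all add: F_def)
  moreover have "\<forall>t\<in>{0..1}. is_lifting (\<lambda>x. ?F (t, x))"
    using lift by simp
  ultimately show ?thesis
    unfolding isotopic_liftings_def homotopic_with_def by (intro exI conjI)
qed

end

section \<open>Assignments as orders\<close>

lemma literal_true_negate: "literal_true A (negate l) \<longleftrightarrow> \<not> literal_true A l"
  by (cases l) simp_all

locale chosen_representatives = nondegenerate_simplicial_map K L f
  for K :: "'v::finite set set" and L :: "'w::finite set set" and f :: "'v \<Rightarrow> 'w" +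
  fixes R :: "(real ^ ('v \<times> 'v)) set set"
  assumes representatives: "orbit_representatives K f R"
begin

abbreviation holds :: "((real ^ ('v \<times> 'v)) set \<Rightarrow> bool) \<Rightarrow> (real ^ ('v \<times> 'v)) set \<Rightarrow> bool" where
  "holds A C \<equiv> literal_true A (component_literal R C)"

lemma representative_component: "C \<in> R \<Longrightarrow> C \<in> double_components K f"
  using representatives by (auto simp: orbit_representatives_def)

lemma unique_representative:
  assumes "C \<in> double_components K f"
  shows "\<exists>!D. D \<in> {C, tau ` C} \<and> D \<in> R"
proof -
  have "{C, tau ` C} \<in> component_orbits K f"
    using assms by (simp add: component_orbits_def)
  then show ?thesis
    using representatives unfolding orbit_representatives_def by (elim conjE) (rule bspec)
qed

text \<open>The orbit of \<open>C\<close> consists of two different components, of which exactly one is a variable and the other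
  its negation.\<close>

lemma holds_tau:
  assumes triv: "p2_trivial K f" and C: "C \<in> double_components K f"
  shows "holds A (tau ` C) \<longleftrightarrow> \<not> holds A C"
proof -
  have "C \<in> R \<longleftrightarrow> tau ` C \<notin> R"
    using unique_representative[OF C] tau_double_component_neq[OF triv C]
    unfolding Ex1_def by blast
  then show ?thesis
    by (simp add: component_literal_def tau_image_image)
qed

lemma satisfies_Gamma_formula_iff:
  "satisfies A (Gamma_formula K f R) \<longleftrightarrow>
    (\<forall>(C, D, E)\<in>transitivity_triples K f. holds A C \<longrightarrow> holds A D \<longrightarrow> holds A E)"
  by (auto simp: satisfies_def Gamma_formula_def literal_true_negate)

text \<open>A pair of vertices lies in exactly one component, and the truth value of that component orients it.\<close>

definition order_of :: "((real ^ ('v \<times> 'v)) set \<Rightarrow> bool) \<Rightarrow> ('v \<times> 'v) set" where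
  "order_of A = {p \<in> double_vertices K f. \<exists>C\<in>double_components K f. vertex_point p \<in> C \<and> holds A C}"

lemma component_double_vertex:
  assumes "C \<in> double_components K f" "vertex_point p \<in> C"
  shows "p \<in> double_vertices K f"
  using assms in_components_subset unfolding double_components_def
  by (metis subsetD vertex_point_in_double_space)

lemma order_of_iff:
  assumes "C \<in> double_components K f" "vertex_point p \<in> C"
  shows "p \<in> order_of A \<longleftrightarrow> holds A C"
  using assms component_double_vertex double_component_unique unfolding order_of_def by blast

lemma order_of_swap:
  assumes triv: "p2_trivial K f" and p: "(v, u) \<in> double_vertices K f"
  shows "(u, v) \<in> order_of A \<longleftrightarrow> (v, u) \<notin> order_of A"
proof -
  obtain C where C: "C \<in> double_components K f" "vertex_point (v, u) \<in> C"
    using p by (rule double_component_exists)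
  have "vertex_point (u, v) \<in> tau ` C"
    using C(2) tau_vertex_point[of v u] by (metis imageI)
  then show ?thesis
    using order_of_iff[OF C] order_of_iff[OF tau_image_double_component[OF C(1)]]
      holds_tau[OF triv C(1)] by blast
qed

text \<open>The clause for three components \<open>C\<close>, \<open>D\<close>, \<open>E\<close> is transitivity for three vertices. The formula has no
  clause when \<open>E\<close> is one of \<open>C\<close> and \<open>D\<close>, but then the implication is trivial.\<close>

lemma order_of_trans:
  assumes triv: "p2_trivial K f" and sat: "satisfies A (Gamma_formula K f R)"
    and ab: "(a, b) \<in> order_of A" and bc: "(b, c) \<in> order_of A"
  shows "(a, c) \<in> order_of A"
proof -
  have dv: "(a, b) \<in> double_vertices K f" "(b, c) \<in> double_vertices K f"
    using ab bc by (auto simp: order_of_def)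
  have "a \<noteq> c"
    using order_of_swap[OF triv dv(1)] ab bc by blast
  then have "(a, c) \<in> double_vertices K f"
    using dv by (auto simp: double_vertices_def)
  then obtain E where E: "E \<in> double_components K f" "vertex_point (a, c) \<in> E"
    by (rule double_component_exists)
  obtain C where C: "C \<in> double_components K f" "vertex_point (a, b) \<in> C"
    using dv(1) by (rule double_component_exists)
  obtain D where D: "D \<in> double_components K f" "vertex_point (b, c) \<in> D"
    using dv(2) by (rule double_component_exists)
  have CD: "holds A C" "holds A D"
    using ab bc order_of_iff[OF C] order_of_iff[OF D] by blast+
  have "holds A E"
  proof (cases "C = E \<or> D = E")
    case True
    then show ?thesis
      using CD by blast
  next
    case False
    have "a \<in> vertices K" "b \<in> vertices K" "c \<in> vertices K"
      using dv by (auto simp: double_vertices_def)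
    then have "(C, D, E) \<in> transitivity_triples K f"
      using False C D E unfolding transitivity_triples_def by blast
    then show ?thesis
      using sat CD unfolding satisfies_Gamma_formula_iff by blast
  qed
  then show ?thesis
    using order_of_iff[OF E] by blast
qed

text \<open>Counting predecessors realises a finite strict linear order by numbers.\<close>

definition fibre_rank :: "((real ^ ('v \<times> 'v)) set \<Rightarrow> bool) \<Rightarrow> 'v \<Rightarrow> real" where
  "fibre_rank A v = real (card {u. (u, v) \<in> order_of A})"

lemma fibre_rank_less:
  assumes triv: "p2_trivial K f" and sat: "satisfies A (Gamma_formula K f R)"
    and p: "(v, u) \<in> order_of A"
  shows "fibre_rank A v < fibre_rank A u"
proof -
  have "(v, v) \<notin> order_of A"
    by (auto simp: order_of_def double_vertices_def)
  then have "{w. (w, v) \<in> order_of A} \<subset> {w. (w, u) \<in> order_of A}"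
    using order_of_trans[OF triv sat _ p] p by blast
  then show ?thesis
    unfolding fibre_rank_def by (simp add: psubset_card_mono)
qed

lemma fibre_rank_less_iff:
  assumes triv: "p2_trivial K f" and sat: "satisfies A (Gamma_formula K f R)"
    and p: "(v, u) \<in> double_vertices K f"
  shows "fibre_rank A v < fibre_rank A u \<longleftrightarrow> (v, u) \<in> order_of A"
  using fibre_rank_less[OF triv sat, of v u] fibre_rank_less[OF triv sat, of u v] order_of_swap[OF triv p, of A]
  by fastforce

text \<open>A simplex of the double complex is connected, so that all its vertices lie in one component and are
  oriented alike.\<close>

lemma separating_fibre_rank:
  assumes triv: "p2_trivial K f" and sat: "satisfies A (Gamma_formula K f R)"
  shows "separating (linear_height (fibre_rank A))"
proof (rule separating_linear_height)
  fix S assume S: "S \<in> double_complex K f"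
  then have dv: "S \<subseteq> double_vertices K f" and "S \<noteq> {}"
    by (auto simp: double_complex_def)
  then obtain p where p: "p \<in> S"
    by blast
  then have "p \<in> double_vertices K f"
    using dv by blast
  then obtain C where C: "C \<in> double_components K f" "vertex_point p \<in> C"
    by (rule double_component_exists)
  have in_C: "vertex_point q \<in> C" if "q \<in> S" for q
    using simplex_in_double_component[OF S p C] that hull_inc[of "vertex_point q"] by blast
  show "(\<forall>(v, u)\<in>S. fibre_rank A v < fibre_rank A u) \<or> (\<forall>(v, u)\<in>S. fibre_rank A u < fibre_rank A v)"
  proof (cases "holds A C")
    case True
    then have "fibre_rank A v < fibre_rank A u" if "(v, u) \<in> S" for v u
      using order_of_iff[OF C(1) in_C[OF that]] fibre_rank_less[OF triv sat] by blast
    then show ?thesis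
      by blast
  next
    case False
    have "fibre_rank A u < fibre_rank A v" if vu: "(v, u) \<in> S" for v u
    proof -
      have "(v, u) \<in> double_vertices K f"
        using vu dv by blast
      then have "(u, v) \<in> order_of A"
        using order_of_swap[OF triv, of v u A] order_of_iff[OF C(1) in_C[OF vu]] False by blast
      then show ?thesis
        by (rule fibre_rank_less[OF triv sat])
    qed
    then show ?thesis
      by blast
  qed
qed

lemma below_fibre_rank:
  assumes "p2_trivial K f" "satisfies A (Gamma_formula K f R)"
  shows "below (linear_height (fibre_rank A)) = order_of A"
proof (rule set_eqI)
  fix p :: "'v \<times> 'v"
  obtain v u where p: "p = (v, u)"
    by (cases p)
  have "(v, u) \<in> order_of A \<Longrightarrow> (v, u) \<in> double_vertices K f"
    by (simp add: order_of_def)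
  then show "p \<in> below (linear_height (fibre_rank A)) \<longleftrightarrow> p \<in> order_of A"
    unfolding p below_def linear_height_vertex_point using fibre_rank_less_iff[OF assms, of v u] by blast
qed

definition assignment :: "(real ^ 'v \<Rightarrow> real) \<Rightarrow> (real ^ ('v \<times> 'v)) set \<Rightarrow> bool" where
  "assignment k = (\<lambda>C\<in>R. \<exists>p\<in>below k. vertex_point p \<in> C)"

text \<open>The assignment is defined by means of the representatives only. For the other component of an orbit, both
  the literal and the order of the pair are reversed.\<close>

lemma holds_assignment:
  assumes k: "separating k" and C: "C \<in> double_components K f" and p: "vertex_point p \<in> C"
  shows "holds (assignment k) C \<longleftrightarrow> p \<in> below k"
proof -
  have rep: "assignment k D \<longleftrightarrow> q \<in> below k" if D: "D \<in> R" "vertex_point q \<in> D" for D q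
  proof -
    have "r \<in> below k \<longleftrightarrow> q \<in> below k" if "vertex_point r \<in> D" for r
      by (rule below_constant_on_component[OF k representative_component[OF D(1)] that D(2)])
    moreover have "assignment k D \<longleftrightarrow> (\<exists>r\<in>below k. vertex_point r \<in> D)"
      using D(1) by (simp add: assignment_def)
    ultimately show ?thesis
      using D(2) by blast
  qed
  show ?thesis
  proof (cases "C \<in> R")
    case True
    then show ?thesis
      using rep[OF True p] by (simp add: component_literal_def)
  next
    case False
    obtain v u where vu: "p = (v, u)"
      by (cases p)
    have "tau ` C \<in> R"
      using unique_representative[OF C] False by blast
    moreover have "vertex_point (u, v) \<in> tau ` C"
      using p tau_vertex_point[of v u] unfolding vu by (metis imageI)
    ultimately have "assignment k (tau ` C) \<longleftrightarrow> (u, v) \<in> below k"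
      by (rule rep)
    then show ?thesis
      using False below_swap[OF k] component_double_vertex[OF C p]
      by (simp add: component_literal_def vu)
  qed
qed

lemma order_of_assignment:
  assumes "separating k"
  shows "order_of (assignment k) = below k"
proof (rule set_eqI)
  fix p
  show "p \<in> order_of (assignment k) \<longleftrightarrow> p \<in> below k"
  proof (cases "p \<in> double_vertices K f")
    case True
    then obtain C where "C \<in> double_components K f" "vertex_point p \<in> C"
      by (rule double_component_exists)
    then show ?thesis
      using order_of_iff holds_assignment[OF assms] by blast
  next
    case False
    then show ?thesis
      by (auto simp: order_of_def below_def)
  qed
qed

lemma satisfies_assignment:
  assumes k: "separating k"
  shows "satisfies (assignment k) (Gamma_formula K f R)"
  unfolding satisfies_Gamma_formula_iff
proof (clarify)
  fix C D E
  assume T: "(C, D, E) \<in> transitivity_triples K f"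
    and CD: "holds (assignment k) C" "holds (assignment k) D"
  obtain a b c where abc: "vertex_point (a, b) \<in> C" "vertex_point (b, c) \<in> D" "vertex_point (a, c) \<in> E"
    and comps: "C \<in> double_components K f" "D \<in> double_components K f" "E \<in> double_components K f"
    using T unfolding transitivity_triples_def by blast
  have "(a, b) \<in> below k" "(b, c) \<in> below k"
    using CD holds_assignment[OF k comps(1) abc(1)] holds_assignment[OF k comps(2) abc(2)] by blast+
  then have "(a, c) \<in> below k"
    using component_double_vertex[OF comps(3) abc(3)] by (auto simp: below_def)
  then show "holds (assignment k) E"
    using holds_assignment[OF k comps(3) abc(3)] by blast
qed

text \<open>Every variable is a component and so has a vertex pair on which the order reads off its value.\<close>

lemma order_of_inject:
  assumes A: "A \<in> R \<rightarrow>\<^sub>E UNIV" and B: "B \<in> R \<rightarrow>\<^sub>E UNIV" and eq: "order_of A = order_of B"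
  shows "A = B"
proof (rule PiE_ext[OF A B])
  fix C assume C: "C \<in> R"
  obtain p where p: "vertex_point p \<in> C"
    using representative_component[OF C] by (rule double_component_vertex)
  have "holds A C \<longleftrightarrow> holds B C"
    using order_of_iff[OF representative_component[OF C] p] eq by blast
  then show "A C = B C"
    using C by (simp add: component_literal_def)
qed

section \<open>The correspondence\<close>

lemma lifts_iff:
  "lifts_to_embedding (realisation K) (realisation L) (induced_map f) \<longleftrightarrow>
    p2_trivial K f \<and> satisfiable (Gamma_formula K f R)"
proof
  assume "lifts_to_embedding (realisation K) (realisation L) (induced_map f)"
  then obtain g where "is_lifting g"
    unfolding lifts_to_embedding_def by blast
  then have "separating (snd \<circ> g)"
    by (rule lifting_separating)
  then show "p2_trivial K f \<and> satisfiable (Gamma_formula K f R)"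
    using p2_trivial_if_separating satisfies_assignment unfolding satisfiable_def by blast
next
  assume "p2_trivial K f \<and> satisfiable (Gamma_formula K f R)"
  then obtain A where "p2_trivial K f" "satisfies A (Gamma_formula K f R)"
    unfolding satisfiable_def by blast
  then have "is_lifting (linear_lift (fibre_rank A))"
    by (intro is_lifting_linear_lift separating_fibre_rank)
  then show "lifts_to_embedding (realisation K) (realisation L) (induced_map f)"
    unfolding lifts_to_embedding_def by blast
qed

lemma isotopic_class_eq_iff:
  assumes "is_lifting g"
  shows "{h. isotopic g h} = {h. isotopic g' h} \<longleftrightarrow> isotopic g g'"
proof
  assume "{h. isotopic g h} = {h. isotopic g' h}"
  moreover have "isotopic g g"
    using assms by (rule isotopic_refl)
  ultimately have "isotopic g' g"
    by blast
  then show "isotopic g g'"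
    by (rule isotopic_sym)
next
  assume "isotopic g g'"
  then show "{h. isotopic g h} = {h. isotopic g' h}"
    using isotopic_sym isotopic_trans by blast
qed

lemma isotopy_classes_eq:
  "isotopy_classes (realisation K) (realisation L) (induced_map f) =
    (\<lambda>g. {h. isotopic g h}) ` {g. is_lifting g}"
  by (auto simp: isotopy_classes_def quotient_def Image_def)

lemma bij_betw_assignments_classes:
  assumes triv: "p2_trivial K f"
  shows "bij_betw (\<lambda>A. {h. isotopic (linear_lift (fibre_rank A)) h}) (satisfying_assignments K f R)
    (isotopy_classes (realisation K) (realisation L) (induced_map f))"
proof (rule bij_betw_imageI)
  have sat: "satisfies A (Gamma_formula K f R)" "A \<in> R \<rightarrow>\<^sub>E UNIV"
    if "A \<in> satisfying_assignments K f R" for A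
    using that by (simp_all add: satisfying_assignments_def)
  have lift: "is_lifting (linear_lift (fibre_rank A))" if "A \<in> satisfying_assignments K f R" for A
    by (rule is_lifting_linear_lift[OF separating_fibre_rank[OF triv sat(1)[OF that]]])
  show "inj_on (\<lambda>A. {h. isotopic (linear_lift (fibre_rank A)) h}) (satisfying_assignments K f R)"
  proof (rule inj_onI)
    fix A B assume A: "A \<in> satisfying_assignments K f R" and B: "B \<in> satisfying_assignments K f R"
      and eq: "{h. isotopic (linear_lift (fibre_rank A)) h} = {h. isotopic (linear_lift (fibre_rank B)) h}"
    have "isotopic (linear_lift (fibre_rank A)) (linear_lift (fibre_rank B))"
      using eq isotopic_class_eq_iff[OF lift[OF A]] by blast
    then have "below (linear_height (fibre_rank A)) = below (linear_height (fibre_rank B))"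
      using isotopic_below by (simp only: snd_linear_lift[symmetric])
    then have "order_of A = order_of B"
      by (simp only: below_fibre_rank[OF triv sat(1)[OF A]] below_fibre_rank[OF triv sat(1)[OF B]])
    then show "A = B"
      by (rule order_of_inject[OF sat(2)[OF A] sat(2)[OF B]])
  qed
  show "(\<lambda>A. {h. isotopic (linear_lift (fibre_rank A)) h}) ` satisfying_assignments K f R =
      isotopy_classes (realisation K) (realisation L) (induced_map f)"
    unfolding isotopy_classes_eq
  proof
    show "(\<lambda>A. {h. isotopic (linear_lift (fibre_rank A)) h}) ` satisfying_assignments K f R
        \<subseteq> (\<lambda>g. {h. isotopic g h}) ` {g. is_lifting g}"
      using lift by blast
    show "(\<lambda>g. {h. isotopic g h}) ` {g. is_lifting g}
        \<subseteq> (\<lambda>A. {h. isotopic (linear_lift (fibre_rank A)) h}) ` satisfying_assignments K f R"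
    proof (rule image_subsetI)
      fix g assume "g \<in> {g. is_lifting g}"
      then have g: "is_lifting g"
        by simp
      let ?A = "assignment (snd \<circ> g)"
      have k: "separating (snd \<circ> g)"
        using g by (rule lifting_separating)
      have A: "?A \<in> satisfying_assignments K f R"
        using satisfies_assignment[OF k] by (simp add: satisfying_assignments_def assignment_def)
      have "below (snd \<circ> g) = below (linear_height (fibre_rank ?A))"
        by (simp only: below_fibre_rank[OF triv sat(1)[OF A]] order_of_assignment[OF k])
      then have "isotopic g (linear_lift (fibre_rank ?A))"
        by (rule isotopic_linear_lift[OF g separating_fibre_rank[OF triv sat(1)[OF A]]])
      then have "{h. isotopic g h} = {h. isotopic (linear_lift (fibre_rank ?A)) h}"
        using isotopic_class_eq_iff[OF g] by blast
      then show "{h. isotopic g h} \<in>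
          (\<lambda>A. {h. isotopic (linear_lift (fibre_rank A)) h}) ` satisfying_assignments K f R"
        using A by blast
    qed
  qed
qed

end

theorem theorem4:
  fixes K :: "'v::finite set set" and L :: "'w::finite set set" and f :: "'v \<Rightarrow> 'w"
    and R :: "(real ^ ('v \<times> 'v)) set set"
  assumes "finite_complex K" and "finite_complex L"
    and "simplicial_map K L f" and "nondegenerate K f"
    and "orbit_representatives K f R"
  shows "(lifts_to_embedding (realisation K) (realisation L) (induced_map f) \<longleftrightarrow>
            p2_trivial K f \<and> satisfiable (Gamma_formula K f R)) \<and>
         (p2_trivial K f \<longrightarrow>
            (\<exists>b. bij_betw b (satisfying_assignments K f R)
                   (isotopy_classes (realisation K) (realisation L) (induced_map f))))"
proof -
  interpret chosen_representatives K L f R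
    by unfold_locales (fact assms)+
  show ?thesis
    using lifts_iff bij_betw_assignments_classes by blast
qed

end
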